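(* Let $(X,\mathcal F)$ be a compact Polish foliated space, and let $X_0\subset X$ be the union of the leaves without holonomy. Consider the equivalence relation on $X$ given by: $x\sim y$ if and only if the leaf $L_x$ is coarsely quasi-isometric to the leaf $L_y$. The relation set $\{(x,y)\mid x\sim y\}$ restricted to $X_0\times X_0$ is a Borel subset of $X_0\times X_0$, and the relation set in $X\times X$ is a Baire subset of $X\times X$. In particular, the equivalence classes of the restriction of $\sim$ to $X_0$ are Borel in $X_0$, and the equivalence classes of $\sim$ in $X$ are Baire subsets of $X$.
   Context: Foliated spaces. A (topological) foliated structure $\mathcal F$ of dimension $n$ on a space $X$ is given by an atlas $\{(U_i,\phi_i)\}$, where $\{U_i\}$ is an open cover of $X$ and $\phi_i:U_i\to B_i\times Z_i$ are homeomorphisms, with $B_i\subset\mathbb R^n$ an open ball and $Z_i$ a locally compact Polish space, whose changes of coordinates are locally of the form $\phi_j\phi_i^{-1}(x,z)=(x_{ij}(x,z),h_{ij}(z))$. The sets $\phi_i^{-1}(B_i\times\{z\})$ are the plaques; the leaves are the connected components of $X$ with the (leaf) topology whose basic open sets are the plaques of all foliated charts. $L_x$ is the leaf through $x$. $(X,\mathcal F)$ is a compact Polish foliated space if $X$ is compact, Hausdorff and second countable. Regular atlas and holonomy. A foliated atlas $\mathcal U=\{(U_i,\phi_i)\}$ is regular if: each $(U_i,\phi_i)$ is the restriction of a foliated chart $(\widetilde U_i,\tilde\phi_i)$ with $\overline{U_i}\subset\widetilde U_i$; $\{U_i\}$ is locally finite; and the closure of every plaque of $(U_i,\phi_i)$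 meets at most the closure of one plaque of $(U_j,\phi_j)$, for all $i,j$. Let $p_i:U_i\to Z_i$ be $\phi_i$ followed by the second projection; there are homeomorphisms $h_{ij}:p_i(U_i\cap U_j)\to p_j(U_i\cap U_j)$ with $p_j=h_{ij}p_i$ on $U_i\cap U_j$, generating the holonomy pseudogroup $\mathcal H$ on $\bigsqcup_iZ_i$. The holonomy group of the leaf through $x\in U_i$ is the group of germs at $p_i(x)$ of maps in $\mathcal H$ fixing $p_i(x)$; a leaf is without holonomy if this group is trivial. Leaf metrics. Fix a regular foliated atlas $\mathcal U$. For $x,y$ in the same leaf, $d^*_{\mathcal U}(x,y)=0$ if $x=y$, and otherwise it is the minimum number of $\mathcal U$-plaques whose union is connected and contains $x$ and $y$. Leaves are considered as metric spaces with $d^*_{\mathcal U}$; the notions used do not depend on the choice of $\mathcal U$. Coarse quasi-isometries. For $K\ge0$, $A\subset M$ is a $K$-net in a metric space $M$ if every point of $M$ is at distance $\le K$ from some point of $A$. For $C\ge1$, a $(K,C)$-coarse quasi-isometry of $M$ to $M'$ is a bijection $f:A\to A'$ between $K$-nets $A\subset M$ and $A'\subset M'$ with $\frac1C d(x,y)\le d'(f(x),f(y))\le C\,d(x,y)$ for all $x,y\in A$. $M$ and $M'$ are coarsely quasi-isometric if such an $f$ exists for some $(K,C)$. Baire subsets. A subset of a topological space is meager if it is a countable union of nowhere dense sets, and Baire (has the Baire property) if its symmetric difference with some open set is meager. *)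

theory Defs
  imports "HOL-Analysis.Analysis"
begin

section \<open>Foliated spaces\<close>

definition is_open_ball :: "nat \<Rightarrow> (nat \<Rightarrow> real) set \<Rightarrow> bool" where
  "is_open_ball n B \<longleftrightarrow>
     (\<exists>a \<in> topspace (Euclidean_space n). \<exists>r>0.
        B = {x \<in> topspace (Euclidean_space n). L2_set (\<lambda>i. x i - a i) {..<n} < r})"

definition Polish_top :: "'z topology \<Rightarrow> bool" where
  "Polish_top Z \<longleftrightarrow> completely_metrizable_space Z \<and> second_countable Z"

text \<open>A chart consists of its domain \<open>U\<close>, the coordinate map \<open>\<phi>\<close> (only its values on
  \<open>U\<close> are relevant), the ball \<open>B\<close> and the transverse space \<open>Z\<close>.  The transverse spaces of
  different charts may be different topologies on different subsets of \<open>'z\<close>.\<close>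

datatype ('a, 'z) chart =
  Chart (dom_of: "'a set") (map_of_chart: "'a \<Rightarrow> (nat \<Rightarrow> real) \<times> 'z")
        (ball_of: "(nat \<Rightarrow> real) set") (trans_of: "'z topology")

definition is_chart :: "nat \<Rightarrow> 'a topology \<Rightarrow> ('a, 'z) chart \<Rightarrow> bool" where
  "is_chart n X c \<longleftrightarrow>
     openin X (dom_of c) \<and>
     is_open_ball n (ball_of c) \<and>
     Polish_top (trans_of c) \<and> locally_compact_space (trans_of c) \<and>
     homeomorphic_map (subtopology X (dom_of c))
       (prod_topology (subtopology (Euclidean_space n) (ball_of c)) (trans_of c))
       (map_of_chart c)"

text \<open>The change of coordinates from \<open>c\<close> to \<open>d\<close> is locally of the form
  \<open>(x, z) \<mapsto> (g (x, z), h z)\<close>.  Continuity of \<open>g\<close> and \<open>h\<close> is automatic (for \<open>h\<close>, after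
  shrinking \<open>W\<close> to a product box), since the coordinate maps are homeomorphisms.\<close>

definition foliated_change :: "'a topology \<Rightarrow> ('a, 'z) chart \<Rightarrow> ('a, 'z) chart \<Rightarrow> bool" where
  "foliated_change X c d \<longleftrightarrow>
     (\<forall>p \<in> dom_of c \<inter> dom_of d. \<exists>W g h.
        openin X W \<and> p \<in> W \<and> W \<subseteq> dom_of c \<inter> dom_of d \<and>
        (\<forall>q \<in> W. \<forall>x z. map_of_chart c q = (x, z) \<longrightarrow> map_of_chart d q = (g (x, z), h z)))"

definition foliated_atlas :: "nat \<Rightarrow> 'a topology \<Rightarrow> ('a, 'z) chart set \<Rightarrow> bool" where
  "foliated_atlas n X \<A> \<longleftrightarrow>
     (\<forall>c \<in> \<A>. is_chart n X c) \<and>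
     (\<Union>c \<in> \<A>. dom_of c) = topspace X \<and>
     (\<forall>c \<in> \<A>. \<forall>d \<in> \<A>. foliated_change X c d)"

definition compact_Polish_foliated_space ::
    "nat \<Rightarrow> 'a topology \<Rightarrow> ('a, 'z) chart set \<Rightarrow> bool" where
  "compact_Polish_foliated_space n X \<A> \<longleftrightarrow>
     compact_space X \<and> Hausdorff_space X \<and> second_countable X \<and> foliated_atlas n X \<A>"

text \<open>All foliated charts of the foliated structure given by the atlas \<open>\<A>\<close>.\<close>

definition foliated_charts :: "nat \<Rightarrow> 'a topology \<Rightarrow> ('a, 'z) chart set \<Rightarrow> ('a, 'z) chart set" where
  "foliated_charts n X \<A> = {c. foliated_atlas n X (insert c \<A>)}"

definition plaques :: "('a, 'z) chart \<Rightarrow> 'a set set" where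
  "plaques c =
     {{q \<in> dom_of c. map_of_chart c q \<in> ball_of c \<times> {z}} | z. z \<in> topspace (trans_of c)}"

definition leaf_topology :: "nat \<Rightarrow> 'a topology \<Rightarrow> ('a, 'z) chart set \<Rightarrow> 'a topology" where
  "leaf_topology n X \<A> = topology_generated_by (\<Union>c \<in> foliated_charts n X \<A>. plaques c)"

definition leaf :: "nat \<Rightarrow> 'a topology \<Rightarrow> ('a, 'z) chart set \<Rightarrow> 'a \<Rightarrow> 'a set" where
  "leaf n X \<A> x = connected_component_of_set (leaf_topology n X \<A>) x"


section \<open>Regular atlases and holonomy\<close>

text \<open>Local finiteness is that of the family of domains indexed by the charts, so it bounds
  the number of charts and not just of distinct domains.\<close>

definition regular_foliated_atlas ::
    "nat \<Rightarrow> 'a topology \<Rightarrow> ('a, 'z) chart set \<Rightarrow> ('a, 'z) chart set \<Rightarrow> bool" where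
  "regular_foliated_atlas n X \<A> \<U> \<longleftrightarrow>
     foliated_atlas n X \<U> \<and> \<U> \<subseteq> foliated_charts n X \<A> \<and>
     (\<forall>c \<in> \<U>. \<exists>c' \<in> foliated_charts n X \<A>.
        X closure_of dom_of c \<subseteq> dom_of c' \<and>
        (\<forall>q \<in> dom_of c. map_of_chart c q = map_of_chart c' q)) \<and>
     (\<forall>x \<in> topspace X. \<exists>V. openin X V \<and> x \<in> V \<and> finite {c \<in> \<U>. dom_of c \<inter> V \<noteq> {}}) \<and>
     (\<forall>c \<in> \<U>. \<forall>d \<in> \<U>. \<forall>P \<in> plaques c. \<forall>Q \<in> plaques d. \<forall>Q' \<in> plaques d.
        X closure_of P \<inter> X closure_of Q \<noteq> {} \<longrightarrow>
        X closure_of P \<inter> X closure_of Q' \<noteq> {} \<longrightarrow>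
        X closure_of Q = X closure_of Q')"

definition transverse_proj :: "('a, 'z) chart \<Rightarrow> 'a \<Rightarrow> 'z" where
  "transverse_proj c q = snd (map_of_chart c q)"

definition total_transversal :: "('a, 'z) chart set \<Rightarrow> (('a, 'z) chart \<times> 'z) topology" where
  "total_transversal \<U> = sum_topology trans_of \<U>"

text \<open>Partial homeomorphisms are represented by their graphs.  The graph of the homeomorphism
  \<open>h\<close> determined by \<open>p\<^sub>d = h \<circ> p\<^sub>c\<close> on \<open>U\<^sub>c \<inter> U\<^sub>d\<close> is the following.\<close>

definition elementary_holonomy ::
    "('a, 'z) chart \<Rightarrow> ('a, 'z) chart \<Rightarrow> (('a, 'z) chart \<times> 'z) rel" where
  "elementary_holonomy c d =
     {((c, transverse_proj c q), (d, transverse_proj d q)) | q. q \<in> dom_of c \<inter> dom_of d}"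

text \<open>The identity need not be added: it is the union of the generators with \<open>c = d\<close>.\<close>

inductive_set holonomy_pseudogroup ::
    "('a, 'z) chart set \<Rightarrow> (('a, 'z) chart \<times> 'z) rel set"
  for \<U> :: "('a, 'z) chart set" where
  gen: "\<lbrakk>c \<in> \<U>; d \<in> \<U>\<rbrakk> \<Longrightarrow> elementary_holonomy c d \<in> holonomy_pseudogroup \<U>"
| comp: "\<lbrakk>f \<in> holonomy_pseudogroup \<U>; g \<in> holonomy_pseudogroup \<U>\<rbrakk> \<Longrightarrow>
           f O g \<in> holonomy_pseudogroup \<U>"
| inv: "f \<in> holonomy_pseudogroup \<U> \<Longrightarrow> f\<inverse> \<in> holonomy_pseudogroup \<U>"
| restrict: "\<lbrakk>f \<in> holonomy_pseudogroup \<U>; openin (total_transversal \<U>) V\<rbrakk> \<Longrightarrow>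
           f \<inter> V \<times> UNIV \<in> holonomy_pseudogroup \<U>"
| union: "\<lbrakk>\<forall>f \<in> G. f \<in> holonomy_pseudogroup \<U>;
           single_valued (\<Union>G); single_valued ((\<Union>G)\<inverse>)\<rbrakk> \<Longrightarrow>
           \<Union>G \<in> holonomy_pseudogroup \<U>"

definition germ :: "'t topology \<Rightarrow> 't \<Rightarrow> 't rel \<Rightarrow> 't rel set" where
  "germ T u f = {g. \<exists>V. openin T V \<and> u \<in> V \<and> f \<inter> V \<times> UNIV = g \<inter> V \<times> UNIV}"

definition holonomy_group ::
    "('a, 'z) chart set \<Rightarrow> ('a, 'z) chart \<times> 'z \<Rightarrow> (('a, 'z) chart \<times> 'z) rel set set" where
  "holonomy_group \<U> u =
     {germ (total_transversal \<U>) u f | f. f \<in> holonomy_pseudogroup \<U> \<and> (u, u) \<in> f}"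

definition trivial_holonomy :: "('a, 'z) chart set \<Rightarrow> ('a, 'z) chart \<times> 'z \<Rightarrow> bool" where
  "trivial_holonomy \<U> u \<longleftrightarrow>
     holonomy_group \<U> u =
       {germ (total_transversal \<U>) u (Id_on (topspace (total_transversal \<U>)))}"

text \<open>The holonomy groups at different points \<open>(c, p\<^sub>c x)\<close> of the same leaf are conjugate.\<close>

definition leaf_without_holonomy :: "('a, 'z) chart set \<Rightarrow> 'a set \<Rightarrow> bool" where
  "leaf_without_holonomy \<U> L \<longleftrightarrow>
     (\<forall>x \<in> L. \<forall>c \<in> \<U>. x \<in> dom_of c \<longrightarrow> trivial_holonomy \<U> (c, transverse_proj c x))"

definition no_holonomy_part ::
    "nat \<Rightarrow> 'a topology \<Rightarrow> ('a, 'z) chart set \<Rightarrow> ('a, 'z) chart set \<Rightarrow> 'a set" where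
  "no_holonomy_part n X \<A> \<U> =
     \<Union> {leaf n X \<A> x | x. x \<in> topspace X \<and> leaf_without_holonomy \<U> (leaf n X \<A> x)}"


section \<open>Coarse geometry of the leaves\<close>

definition leaf_dist ::
    "nat \<Rightarrow> 'a topology \<Rightarrow> ('a, 'z) chart set \<Rightarrow> ('a, 'z) chart set \<Rightarrow> 'a \<Rightarrow> 'a \<Rightarrow> real" where
  "leaf_dist n X \<A> \<U> x y =
     (if x = y then 0
      else real (LEAST k. \<exists>\<P>. finite \<P> \<and> card \<P> = k \<and> \<P> \<subseteq> (\<Union>c \<in> \<U>. plaques c) \<and>
                   connectedin (leaf_topology n X \<A>) (\<Union>\<P>) \<and> x \<in> \<Union>\<P> \<and> y \<in> \<Union>\<P>))"

definition is_net :: "real \<Rightarrow> 'm set \<Rightarrow> ('m \<Rightarrow> 'm \<Rightarrow> real) \<Rightarrow> 'm set \<Rightarrow> bool" where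
  "is_net K M d A \<longleftrightarrow> A \<subseteq> M \<and> (\<forall>x \<in> M. \<exists>a \<in> A. d x a \<le> K)"

definition coarse_quasi_isometry ::
    "real \<Rightarrow> real \<Rightarrow> 'm set \<Rightarrow> ('m \<Rightarrow> 'm \<Rightarrow> real) \<Rightarrow> 'k set \<Rightarrow> ('k \<Rightarrow> 'k \<Rightarrow> real) \<Rightarrow>
     'm set \<Rightarrow> 'k set \<Rightarrow> ('m \<Rightarrow> 'k) \<Rightarrow> bool" where
  "coarse_quasi_isometry K C M d M' d' A A' f \<longleftrightarrow>
     is_net K M d A \<and> is_net K M' d' A' \<and> bij_betw f A A' \<and>
     (\<forall>x \<in> A. \<forall>y \<in> A. 1 / C * d x y \<le> d' (f x) (f y) \<and> d' (f x) (f y) \<le> C * d x y)"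

definition coarsely_quasi_isometric ::
    "'m set \<Rightarrow> ('m \<Rightarrow> 'm \<Rightarrow> real) \<Rightarrow> 'k set \<Rightarrow> ('k \<Rightarrow> 'k \<Rightarrow> real) \<Rightarrow> bool" where
  "coarsely_quasi_isometric M d M' d' \<longleftrightarrow>
     (\<exists>K\<ge>0. \<exists>C\<ge>1. \<exists>A A' f. coarse_quasi_isometry K C M d M' d' A A' f)"

definition leaf_cqi ::
    "nat \<Rightarrow> 'a topology \<Rightarrow> ('a, 'z) chart set \<Rightarrow> ('a, 'z) chart set \<Rightarrow> 'a rel" where
  "leaf_cqi n X \<A> \<U> =
     {(x, y). x \<in> topspace X \<and> y \<in> topspace X \<and>
        coarsely_quasi_isometric (leaf n X \<A> x) (leaf_dist n X \<A> \<U>)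
                                 (leaf n X \<A> y) (leaf_dist n X \<A> \<U>)}"


section \<open>Borel sets and the Baire property in abstract topologies\<close>

definition borel_in :: "'t topology \<Rightarrow> 't set \<Rightarrow> bool" where
  "borel_in T S \<longleftrightarrow> S \<in> sigma_sets (topspace T) {U. openin T U}"

definition nowhere_dense_in :: "'t topology \<Rightarrow> 't set \<Rightarrow> bool" where
  "nowhere_dense_in T S \<longleftrightarrow> S \<subseteq> topspace T \<and> T interior_of (T closure_of S) = {}"

definition meager_in :: "'t topology \<Rightarrow> 't set \<Rightarrow> bool" where
  "meager_in T S \<longleftrightarrow> (\<exists>N :: nat \<Rightarrow> 't set. (\<forall>i. nowhere_dense_in T (N i)) \<and> S = (\<Union>i. N i))"

definition baire_in :: "'t topology \<Rightarrow> 't set \<Rightarrow> bool" where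
  "baire_in T S \<longleftrightarrow>
     S \<subseteq> topspace T \<and> (\<exists>U. openin T U \<and> meager_in T ((S - U) \<union> (U - S)))"

end

theory Submission
  imports Defs
begin

text \<open>
  The relation is Borel on all of \<open>X \<times> X\<close>, hence has the Baire property. A leaf is the class of a
  point under chains of plaques, its metric counts the plaques of such a chain, and by regularity
  a plaque meets at most one plaque of each of the finitely many nonempty charts. Hence the leaf
  of \<open>x\<close> has a net of plaque centers indexed by finite words in the holonomy maps, each defined
  and continuous on an open set of points \<open>x\<close>; whether two words lead to a common plaque is a
  Borel condition on \<open>x\<close>, since the transverse spaces are Hausdorff. Two leaves are coarsely
  quasi-isometric iff some map between words preserves distances up to a common affine distortion
  and is coarsely onto. It may be taken to increase word length at most affinely, so it has finitely
  many possible values at each word, and by compactness it exists iff each finite set of its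
  conditions can be met. The relation is thus a countable combination of Borel conditions.
\<close>

section \<open>Borel sets and the Baire property\<close>

text \<open>A quantifier over all maps between two countable sets of words ranges over an
  uncountable space and by itself yields only an analytic set. The bound on word length replaces
  this space by a compact product of finite sets. It costs nothing: for suitably chosen words, word
  length and distance of the coded point from the base point are comparable, and a coarse
  quasi-isometry distorts that distance affinely; the displacement of base points only enters the
  additive constant. The same bound confines the witnesses of coarse surjectivity to a finite set,
  so each condition reads finitely many values of the map. Representing a plaque by a fixed ball
  coordinate makes the coded point a function of the plaque alone, so holonomy becomes a continuous
  map between points of \<open>X\<close>. Whether two words reach a common plaque can jump with
  \<open>x\<close>; but on the open set where both end in one chart, having different transverse
  coordinates is an open condition.\<close>

lemma nowhere_dense_in_subset:
  "nowhere_dense_in T S \<Longrightarrow> S' \<subseteq> S \<Longrightarrow> nowhere_dense_in T S'"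
  unfolding nowhere_dense_in_def
  by (metis closure_of_mono interior_of_mono order_trans subset_empty)

text \<open>This boundary is the error made when the complement of an open set is replaced by an
  open set.\<close>

lemma nowhere_dense_in_closed_diff_interior:
  assumes "closedin T F"
  shows "nowhere_dense_in T (F - T interior_of F)"
proof -
  have "closedin T (F - T interior_of F)"
    using assms by (simp add: closedin_diff)
  moreover have "T interior_of (F - T interior_of F) = {}"
    using interior_of_subset[of T "F - T interior_of F"]
      interior_of_mono[of "F - T interior_of F" F T] by blast
  ultimately show ?thesis
    by (simp add: nowhere_dense_in_def closure_of_closedin closedin_subset)
qed

lemma meager_in_subset:
  assumes "meager_in T S" "S' \<subseteq> S"
  shows "meager_in T S'"
proof -
  obtain N :: "nat \<Rightarrow> _" where N: "\<And>i. nowhere_dense_in T (N i)" "S = (\<Union>i. N i)"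
    using assms(1) unfolding meager_in_def by blast
  have "nowhere_dense_in T (N i \<inter> S')" for i
    using N(1) nowhere_dense_in_subset by (metis inf_le1)
  moreover have "S' = (\<Union>i. N i \<inter> S')"
    using assms(2) N(2) by auto
  ultimately show ?thesis
    unfolding meager_in_def by metis
qed

lemma meager_in_UN:
  fixes S :: "nat \<Rightarrow> 't set"
  assumes "\<And>i. meager_in T (S i)"
  shows "meager_in T (\<Union>i. S i)"
proof -
  obtain N :: "nat \<Rightarrow> nat \<Rightarrow> _"
    where N: "\<And>i j. nowhere_dense_in T (N i j)" "\<And>i. S i = (\<Union>j. N i j)"
    using assms unfolding meager_in_def by metis
  have "(\<Union>i. S i) = (\<Union>k. N (fst (prod_decode k)) (snd (prod_decode k)))"
  proof (intro equalityI subsetI)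
    fix x assume "x \<in> (\<Union>i. S i)"
    then obtain i j where "x \<in> N i j" using N(2) by auto
    then show "x \<in> (\<Union>k. N (fst (prod_decode k)) (snd (prod_decode k)))"
      by (intro UN_I[of "prod_encode (i, j)"]) auto
  qed (use N(2) in blast)
  then show ?thesis
    unfolding meager_in_def using N(1)
    by (intro exI[of _ "\<lambda>k. N (fst (prod_decode k)) (snd (prod_decode k))"]) simp
qed

lemma nowhere_dense_in_imp_meager_in: "nowhere_dense_in T S \<Longrightarrow> meager_in T S"
  unfolding meager_in_def by (intro exI[of _ "\<lambda>_. S"]) auto

lemma meager_in_Un:
  assumes "meager_in T A" "meager_in T B"
  shows "meager_in T (A \<union> B)"
proof -
  let ?S = "\<lambda>i::nat. if i = 0 then A else B"
  have "meager_in T (\<Union>i. ?S i)"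
    by (rule meager_in_UN) (simp add: assms)
  moreover have "A \<union> B \<subseteq> (\<Union>i. ?S i)"
    by (auto intro: exI[of _ "0::nat"] exI[of _ "1::nat"])
  ultimately show ?thesis by (rule meager_in_subset)
qed

text \<open>The sets that are open modulo a meager set form a sigma-algebra containing the open
  sets. For a complement, the closed set \<open>topspace T - U\<close> is exchanged for its
  interior, at the price of its nowhere dense boundary.\<close>

lemma borel_in_imp_baire_in:
  assumes "borel_in T S"
  shows "baire_in T S"
  using assms unfolding borel_in_def
proof (induction rule: sigma_sets.induct)
  case (Basic U)
  then show ?case
    unfolding baire_in_def
    by (auto intro!: exI[of _ U] nowhere_dense_in_imp_meager_in
        simp: openin_subset nowhere_dense_in_def)
next
  case Empty
  then show ?case
    unfolding baire_in_def
    by (auto intro!: exI[of _ "{}"] nowhere_dense_in_imp_meager_in simp: nowhere_dense_in_def)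
next
  case (Compl S)
  then obtain U where U: "openin T U" "meager_in T ((S - U) \<union> (U - S))" "S \<subseteq> topspace T"
    unfolding baire_in_def by blast
  define F where "F = topspace T - U"
  let ?V = "T interior_of F"
  have "closedin T F" using U(1) by (simp add: F_def closedin_diff)
  then have "meager_in T (F - ?V)"
    by (intro nowhere_dense_in_imp_meager_in nowhere_dense_in_closed_diff_interior)
  then have "meager_in T (((S - U) \<union> (U - S)) \<union> (F - ?V))"
    by (rule meager_in_Un[OF U(2)])
  moreover have "?V \<subseteq> F" by (rule interior_of_subset)
  ultimately have "meager_in T ((topspace T - S - ?V) \<union> (?V - (topspace T - S)))"
    by (elim meager_in_subset) (auto simp: F_def)
  then show ?case
    unfolding baire_in_def using openin_interior_of by blast
next
  case (Union S)
  then obtain U where U: "\<And>i. openin T (U i)" "\<And>i. meager_in T ((S i - U i) \<union> (U i - S i))"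
    "\<And>i. S i \<subseteq> topspace T"
    unfolding baire_in_def by metis
  have "meager_in T (((\<Union>i. S i) - (\<Union>i. U i)) \<union> ((\<Union>i. U i) - (\<Union>i. S i)))"
    by (rule meager_in_subset[OF meager_in_UN[OF U(2)]]) auto
  moreover have "openin T (\<Union>i. U i)" using U(1) by blast
  moreover have "(\<Union>i. S i) \<subseteq> topspace T" using U(3) by blast
  ultimately show ?case unfolding baire_in_def by blast
qed

section \<open>Borel sigma-algebras of abstract topologies as measurable spaces\<close>

text \<open>Borel sets are packaged as a measure so that the \<open>measurable\<close> method and
  the rules for countable quantifiers apply to them; only the space and the measurable sets
  matter.\<close>

definition borel_of :: "'t topology \<Rightarrow> 't measure" where
  "borel_of T = sigma (topspace T) {U. openin T U}"

lemma space_borel_of [simp]: "space (borel_of T) = topspace T"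
  and sets_borel_of: "sets (borel_of T) = sigma_sets (topspace T) {U. openin T U}"
proof -
  have "{U. openin T U} \<subseteq> Pow (topspace T)" using openin_subset by blast
  then show "space (borel_of T) = topspace T"
    "sets (borel_of T) = sigma_sets (topspace T) {U. openin T U}"
    by (simp_all add: borel_of_def space_measure_of_conv)
qed

lemma borel_in_iff_sets: "borel_in T S \<longleftrightarrow> S \<in> sets (borel_of T)"
  by (simp add: borel_in_def sets_borel_of)

lemma openin_imp_sets_borel_of: "openin T U \<Longrightarrow> U \<in> sets (borel_of T)"
  by (auto simp: sets_borel_of)

lemma continuous_map_imp_measurable:
  assumes "continuous_map T T' f"
  shows "f \<in> measurable (borel_of T) (borel_of T')"
  unfolding borel_of_def[of T']
proof (rule measurable_measure_of)
  show "{U. openin T' U} \<subseteq> Pow (topspace T')" using openin_subset by blast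
  show "f \<in> space (borel_of T) \<rightarrow> topspace T'"
    using assms by (auto simp: continuous_map_def)
  show "f -` U \<inter> space (borel_of T) \<in> sets (borel_of T)" if "U \<in> {U. openin T' U}" for U
    using openin_continuous_map_preimage[OF assms, of U] that
    by (auto intro!: openin_imp_sets_borel_of simp: Int_def vimage_def conj_commute)
qed

lemma borel_in_continuous_map_preimage:
  assumes "continuous_map T T' f" "borel_in T' S"
  shows "borel_in T {x \<in> topspace T. f x \<in> S}"
  using measurable_sets[OF continuous_map_imp_measurable[OF assms(1)], of S] assms(2)
  by (simp add: borel_in_iff_sets Int_def vimage_def conj_commute)


section \<open>Coarse quasi-isometries and nets\<close>

text \<open>Zorn's lemma gives a maximal \<open>r\<close>-separated set. A point at distance at
  least \<open>r\<close> from all of it could be added, so maximality makes it a net.\<close>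

lemma (in Metric_space) maximal_separated_subset:
  fixes r :: real
  assumes "r > 0"
  obtains A where "A \<subseteq> M" "\<And>x y. x \<in> A \<Longrightarrow> y \<in> A \<Longrightarrow> x \<noteq> y \<Longrightarrow> r \<le> d x y"
    "\<And>x. x \<in> M \<Longrightarrow> \<exists>a\<in>A. d x a < r"
proof -
  let ?S = "{A. A \<subseteq> M \<and> (\<forall>x\<in>A. \<forall>y\<in>A. x \<noteq> y \<longrightarrow> r \<le> d x y)}"
  have "\<exists>A\<in>?S. \<forall>B\<in>?S. A \<subseteq> B \<longrightarrow> B = A"
  proof (rule subset_Zorn')
    fix \<C> assume ch: "subset.chain ?S \<C>"
    then have sub: "\<C> \<subseteq> ?S" and lin: "\<And>A B. A \<in> \<C> \<Longrightarrow> B \<in> \<C> \<Longrightarrow> A \<subseteq> B \<or> B \<subseteq> A"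
      by (auto simp: subset_chain_def)
    have "r \<le> d x y" if "A \<in> \<C>" "x \<in> A" "B \<in> \<C>" "y \<in> B" "x \<noteq> y" for A B x y
      using lin[OF that(1,3)] that sub by blast
    then show "\<Union>\<C> \<in> ?S" using sub by blast
  qed
  then obtain A where A: "A \<in> ?S" and "\<forall>B\<in>?S. A \<subseteq> B \<longrightarrow> B = A" by (rule bexE)
  then have max: "B = A" if "B \<in> ?S" "A \<subseteq> B" for B using that by simp
  have "\<exists>a\<in>A. d x a < r" if x: "x \<in> M" for x
  proof (rule ccontr)
    assume neg: "\<not> (\<exists>a\<in>A. d x a < r)"
    then have "insert x A \<in> ?S"
      using A x commute by (auto simp: not_less)
    then have "insert x A = A" by (rule max) blast
    then have "x \<in> A" by blast
    moreover have "d x x = 0" using x by simp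
    ultimately show False using neg assms by force
  qed
  moreover have "A \<subseteq> M" "\<And>x y. x \<in> A \<Longrightarrow> y \<in> A \<Longrightarrow> x \<noteq> y \<Longrightarrow> r \<le> d x y"
    using A by auto
  ultimately show thesis by (rule that[rotated -1])
qed

text \<open>The definition asks for a bijection of nets with purely multiplicative bounds. On a
  \<open>2 * L\<close>-separated net, distinct points satisfy \<open>L\<close> \<le>
  \<open>d x y / 2\<close> and \<open>1\<close> \<le> \<open>d x y\<close>, so the additive
  constants are absorbed into the factor \<open>2 * L\<close>, and the lower bound makes
  \<open>F\<close> injective.\<close>

lemma coarsely_quasi_isometric_if_quasi_isometry:
  fixes L :: real
  assumes "Metric_space M d" "Metric_space M' d'" and L: "L \<ge> 1"
    and F: "\<And>x. x \<in> M \<Longrightarrow> F x \<in> M'"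
    and up: "\<And>x y. x \<in> M \<Longrightarrow> y \<in> M \<Longrightarrow> d' (F x) (F y) \<le> L * d x y + L"
    and lo: "\<And>x y. x \<in> M \<Longrightarrow> y \<in> M \<Longrightarrow> d x y \<le> L * d' (F x) (F y) + L"
    and onto: "\<And>y. y \<in> M' \<Longrightarrow> \<exists>x\<in>M. d' (F x) y \<le> L"
  shows "coarsely_quasi_isometric M d M' d'"
proof -
  interpret M: Metric_space M d by fact
  interpret M': Metric_space M' d' by fact
  from L have "2 * L > 0" by simp
  then obtain A where A: "A \<subseteq> M" and sep: "\<And>x y. x \<in> A \<Longrightarrow> y \<in> A \<Longrightarrow> x \<noteq> y \<Longrightarrow> 2 * L \<le> d x y"
    and net: "\<And>x. x \<in> M \<Longrightarrow> \<exists>a\<in>A. d x a < 2 * L"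
    using M.maximal_separated_subset[of "2 * L"] by blast
  \<comment> \<open>The distance from \<open>y\<close> to \<open>F a\<close>: one \<open>L\<close>
    from \<open>y\<close> to some \<open>F x\<close>, and \<open>L * (2 * L) + L\<close> for the
    image of a step from \<open>x\<close> to a net point \<open>a\<close> closer than
    \<open>2 * L\<close>.\<close>
  define K where "K = L * (2 * L) + L + L"
  have K: "2 * L \<le> K"
    using L mult_mono[of 0 L 0 "2*L"] by (simp add: K_def)
  have bounds: "1 / (2 * L) * d x y \<le> d' (F x) (F y) \<and> d' (F x) (F y) \<le> 2 * L * d x y"
    if "x \<in> A" "y \<in> A" for x y
  proof (cases "x = y")
    case True
    have "d x x = 0" "d' (F x) (F x) = 0" using that A F by auto
    then show ?thesis using True by simp
  next
    case False
    then have s: "2 * L \<le> d x y" using sep that by blast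
    have "d x y \<le> L * d' (F x) (F y) + L" using lo that A by blast
    then have "d x y \<le> 2 * L * d' (F x) (F y)" using s by simp
    then have 1: "1 / (2 * L) * d x y \<le> d' (F x) (F y)" using L by (simp add: field_simps)
    have "1 \<le> d x y" using s L by simp
    then have "L \<le> L * d x y" using L by simp
    moreover have "d' (F x) (F y) \<le> L * d x y + L" using up that A by blast
    ultimately have "d' (F x) (F y) \<le> 2 * L * d x y" by simp
    with 1 show ?thesis by blast
  qed
  have "inj_on F A"
  proof (rule inj_onI)
    fix x y assume xy: "x \<in> A" "y \<in> A" "F x = F y"
    have "d' (F x) (F x) = 0" using xy A F by auto
    then have "1 / (2 * L) * d x y \<le> 0" using bounds[of x y] xy by simp
    then have "d x y \<le> 0" using L by (simp add: field_simps mult_le_0_iff)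
    then show "x = y" using xy A M.zero M.nonneg[of x y] by (metis antisym subsetD)
  qed
  then have "bij_betw F A (F ` A)" by (simp add: bij_betw_def)
  moreover have "is_net K M d A"
    unfolding is_net_def
  proof (intro conjI ballI A)
    fix x assume "x \<in> M"
    then obtain a where "a \<in> A" "d x a < 2 * L" using net by blast
    then show "\<exists>a\<in>A. d x a \<le> K" using K by (intro bexI[of _ a]) linarith+
  qed
  moreover have "is_net K M' d' (F ` A)"
    unfolding is_net_def
  proof (intro conjI ballI)
    show "F ` A \<subseteq> M'" using A F by blast
    fix y assume y: "y \<in> M'"
    then obtain x where x: "x \<in> M" "d' (F x) y \<le> L" using onto by blast
    then obtain a where a: "a \<in> A" "d x a < 2 * L" using net by blast
    have "d' y (F a) \<le> d' y (F x) + d' (F x) (F a)"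
      using M'.triangle y x a A F by blast
    moreover have "d' (F x) (F a) \<le> L * d x a + L" using up x a A by blast
    moreover have "L * d x a \<le> L * (2 * L)" using a L by (intro mult_left_mono) auto
    ultimately have "d' y (F a) \<le> K" using x(2) by (simp add: K_def M'.commute[of y])
    then show "\<exists>a\<in>F ` A. d' y a \<le> K" using a by blast
  qed
  ultimately have "coarse_quasi_isometry K (2 * L) M d M' d' A (F ` A) F"
    unfolding coarse_quasi_isometry_def using bounds by blast
  moreover have "K \<ge> 0" "2 * L \<ge> 1" using K L by auto
  ultimately show ?thesis
    unfolding coarsely_quasi_isometric_def by blast
qed


section \<open>Coarse matchings of coded spaces\<close>

text \<open>Tychonoff's theorem for finite discrete spaces: a condition that reads finitely many
  coordinates defines a closed set, and the hypothesis \<open>ex\<close> is the finite intersection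
  property.\<close>

lemma finitary_compactness:
  fixes F :: "'w \<Rightarrow> 'v set" and S :: "'i \<Rightarrow> 'w set"
  assumes F: "\<And>w. finite (F w)" and S: "\<And>i. finite (S i)"
    and dep: "\<And>i f g. (\<And>w. w \<in> S i \<Longrightarrow> f w = g w) \<Longrightarrow> P i f \<Longrightarrow> P i g"
    and ex: "\<And>J. finite J \<Longrightarrow> \<exists>f. (\<forall>w. f w \<in> F w) \<and> (\<forall>i\<in>J. P i f)"
  shows "\<exists>f. (\<forall>w. f w \<in> F w) \<and> (\<forall>i. P i f)"
proof -
  let ?T = "product_topology (\<lambda>w. discrete_topology (F w)) UNIV"
  let ?C = "\<lambda>i. {f \<in> topspace ?T. P i f}"
  have top: "f \<in> topspace ?T \<longleftrightarrow> (\<forall>w. f w \<in> F w)" for f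
    by auto
  have "compact_space ?T"
    using F by (simp add: compact_space_product_topology compact_space_discrete_topology)
  have "openin ?T (topspace ?T - ?C i)" for i
  proof (subst openin_subopen, intro ballI)
    fix f assume f: "f \<in> topspace ?T - ?C i"
    \<comment> \<open>A cylinder: only the finitely many coordinates in \<open>S i\<close> are
      restricted, which makes it open in the product, and \<open>P i\<close> cannot distinguish its
      members from \<open>f\<close>.\<close>
    let ?U = "PiE UNIV (\<lambda>w. if w \<in> S i then {f w} else F w)"
    have "openin ?T ?U"
      using f S[of i] top[of f]
      by (intro iffD2[OF openin_PiE_gen] disjI2 conjI ballI)
        (auto elim!: finite_subset[rotated] split: if_splits)
    moreover have "f \<in> ?U" using f top[of f] by auto
    moreover have "?U \<subseteq> topspace ?T - ?C i"
    proof
      fix g assume g: "g \<in> ?U"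
      have eq: "g w = f w" if "w \<in> S i" for w
        using g that by (auto dest!: PiE_mem[of g UNIV _ w])
      have "g w \<in> F w" for w
        using g f top[of f] by (auto dest!: PiE_mem[of g UNIV _ w] split: if_splits)
      moreover have "\<not> P i g"
        using dep[of i g f] eq f by auto
      ultimately show "g \<in> topspace ?T - ?C i"
        using top[of g] by blast
    qed
    ultimately show "\<exists>U. openin ?T U \<and> f \<in> U \<and> U \<subseteq> topspace ?T - ?C i" by blast
  qed
  then have cl: "closedin ?T (?C i)" for i
    unfolding closedin_def by blast
  have fip: "\<Inter>\<F> \<noteq> {}" if \<F>: "finite \<F>" "\<F> \<subseteq> range ?C" for \<F>
  proof -
    obtain J where J: "finite J" "\<F> = ?C ` J"
      using finite_subset_image[OF \<F>] by blast
    then obtain f where "\<forall>w. f w \<in> F w" "\<forall>i\<in>J. P i f" using ex by blast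
    then have "f \<in> \<Inter>\<F>" using J top[of f] by blast
    then show ?thesis by blast
  qed
  have "\<Inter>(range ?C) \<noteq> {}"
    using \<open>compact_space ?T\<close>[unfolded compact_space_fip, rule_format, of "range ?C"] cl fip
    by blast
  then show ?thesis using top by blast
qed

text \<open>\<open>D\<close> and \<open>D'\<close> are the sets of valid codes. The first clause
  distorts distances affinely in both directions; the second is coarse surjectivity, with a length
  bound on the witness \<open>v\<close> so that only finitely many values of \<open>f\<close> are
  consulted when balls of words are finite.\<close>

definition match_at ::
    "('w \<Rightarrow> nat) \<Rightarrow> nat \<Rightarrow> 'w set \<Rightarrow> ('w \<Rightarrow> 'w \<Rightarrow> nat \<Rightarrow> bool) \<Rightarrow> 'w set \<Rightarrow>
     ('w \<Rightarrow> 'w \<Rightarrow> nat \<Rightarrow> bool) \<Rightarrow> ('w \<Rightarrow> 'w) \<Rightarrow> 'w \<Rightarrow> 'w \<Rightarrow> nat \<Rightarrow> bool" where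
  "match_at l C D N D' N' f w w' k \<longleftrightarrow>
     (w \<in> D \<longrightarrow> w' \<in> D \<longrightarrow> f w \<in> D' \<and>
        (N w w' k \<longrightarrow> N' (f w) (f w') (C * k + C)) \<and>
        (N' (f w) (f w') k \<longrightarrow> N w w' (C * k + C))) \<and>
     (w \<in> D' \<longrightarrow> (\<exists>v. l v \<le> C * l w + C \<and> v \<in> D \<and> N' (f v) w C))"

text \<open>The length bound is imposed on words outside \<open>D\<close> as well: the finite sets
  of candidate values then do not depend on \<open>D\<close>, which will vary with the point of the
  foliated space.\<close>

definition coarse_match ::
    "('w \<Rightarrow> nat) \<Rightarrow> 'w set \<Rightarrow> ('w \<Rightarrow> 'w \<Rightarrow> nat \<Rightarrow> bool) \<Rightarrow> 'w set \<Rightarrow>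
     ('w \<Rightarrow> 'w \<Rightarrow> nat \<Rightarrow> bool) \<Rightarrow> bool" where
  "coarse_match l D N D' N' \<longleftrightarrow>
     (\<exists>C f. (\<forall>w. l (f w) \<le> C * l w + C) \<and> (\<forall>w w' k. match_at l C D N D' N' f w w' k))"

lemma match_at_cong:
  assumes "\<And>v. v = w \<or> v = w' \<or> l v \<le> C * l w + C \<Longrightarrow> f v = g v"
    and "match_at l C D N D' N' f w w' k"
  shows "match_at l C D N D' N' g w w' k"
  using assms unfolding match_at_def by metis

text \<open>By compactness, the search for a matching \<open>f\<close> splits into countably many finite searches.\<close>

lemma coarse_match_iff_finite:
  fixes l :: "'w \<Rightarrow> nat"
  assumes fin: "\<And>k. finite {w. l w \<le> k}"
  defines "V \<equiv> \<lambda>C J. \<Union>(w, w', k)\<in>J. {v. v = w \<or> v = w' \<or> l v \<le> C * l w + C}"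
  shows "coarse_match l D N D' N' \<longleftrightarrow>
     (\<exists>C. \<forall>js. \<exists>f\<in>PiE (V C (set js)) (\<lambda>w. {v. l v \<le> C * l w + C}).
        \<forall>(w, w', k)\<in>set js. match_at l C D N D' N' f w w' k)" (is "_ \<longleftrightarrow> ?R")
proof
  assume "coarse_match l D N D' N'"
  then obtain C f where f: "\<And>w. l (f w) \<le> C * l w + C"
    "\<And>w w' k. match_at l C D N D' N' f w w' k"
    unfolding coarse_match_def by blast
  have "\<exists>g\<in>PiE (V C J) (\<lambda>w. {v. l v \<le> C * l w + C}).
        \<forall>(w, w', k)\<in>J. match_at l C D N D' N' g w w' k" for J
  proof (intro bexI[of _ "restrict f (V C J)"] ballI, clarify)
    fix w w' k assume J: "(w, w', k) \<in> J"
    show "match_at l C D N D' N' (restrict f (V C J)) w w' k"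
      by (rule match_at_cong[OF _ f(2)]) (use J in \<open>force simp: V_def\<close>)
  qed (use f(1) in auto)
  then show ?R by blast
next
  assume ?R
  then obtain C where ex: "\<And>J. finite J \<Longrightarrow> \<exists>f\<in>PiE (V C J) (\<lambda>w. {v. l v \<le> C * l w + C}).
        \<forall>(w, w', k)\<in>J. match_at l C D N D' N' f w w' k" by (metis finite_list)
  let ?F = "\<lambda>w. {v. l v \<le> C * l w + C}"
  let ?S = "\<lambda>(w, w', k::nat). {v. v = w \<or> v = w' \<or> l v \<le> C * l w + C}"
  let ?P = "\<lambda>(w, w', k) f. match_at l C D N D' N' f w w' k"
  \<comment> \<open>The finite solutions must be extended beyond \<open>V C J\<close> by admissible
    values. That one exists at \<open>w\<close>, also for \<open>C = 0\<close>, is read off from a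
    solution of the single condition \<open>(w, w, 0)\<close>.\<close>
  have ne: "\<exists>v. v \<in> ?F w" for w
  proof -
    obtain f where "f \<in> PiE (V C {(w, w, 0)}) ?F" using ex[of "{(w, w, 0)}"] by blast
    moreover have "w \<in> V C {(w, w, 0)}" by (simp add: V_def)
    ultimately show ?thesis by (blast dest: PiE_mem)
  qed
  have "\<exists>f. (\<forall>w. f w \<in> ?F w) \<and> (\<forall>i. ?P i f)"
  proof (rule finitary_compactness[of ?F ?S ?P])
    show "finite (?F w)" for w by (rule fin)
    show "finite (?S i)" for i
    proof (cases i)
      case (fields w w' k)
      have "?S i \<subseteq> insert w (insert w' (?F w))" using fields by auto
      then show ?thesis using fin by (rule finite_subset[OF _ finite.insertI[OF finite.insertI]])
    qed
    show "?P i g" if "\<And>w. w \<in> ?S i \<Longrightarrow> f w = g w" "?P i f" for i f g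
    proof (cases i)
      case (fields w w' k)
      then show ?thesis using that match_at_cong[of w w' l C f g D N D' N' k] by auto
    qed
    show "\<exists>f. (\<forall>w. f w \<in> ?F w) \<and> (\<forall>i\<in>J. ?P i f)" if J: "finite J" for J
    proof -
      obtain f where f: "f \<in> PiE (V C J) ?F" "\<forall>(w, w', k)\<in>J. match_at l C D N D' N' f w w' k"
        using ex[OF J] by blast
      define g where "g = (\<lambda>w. if w \<in> V C J then f w else SOME v. v \<in> ?F w)"
      have "g w \<in> ?F w" for w
        using PiE_mem[OF f(1), of w] someI_ex[OF ne[of w]] by (auto simp: g_def)
      moreover have "?P i g" if "i \<in> J" for i
      proof (cases i)
        case (fields w w' k)
        have "match_at l C D N D' N' f w w' k" using f(2) that fields by blast
        moreover have "f v = g v" if "v = w \<or> v = w' \<or> l v \<le> C * l w + C" for v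
          using \<open>i \<in> J\<close> fields that by (force simp: g_def V_def)
        ultimately show ?thesis using fields match_at_cong[of w w' l C f g D N D' N' k] by auto
      qed
      ultimately show ?thesis by blast
    qed
  qed
  then show "coarse_match l D N D' N'"
    unfolding coarse_match_def by (intro exI[of _ C]) auto
qed

text \<open>In the finite form, \<open>C\<close> and \<open>js\<close> range over countable types
  and \<open>f\<close> over a finite set independent of \<open>x\<close>, so only countable unions
  and intersections of the given measurable conditions occur.\<close>

lemma pred_coarse_match:
  fixes l :: "'w::countable \<Rightarrow> nat"
  assumes fin: "\<And>k. finite {w. l w \<le> k}"
    and [measurable]: "\<And>w. Measurable.pred M (\<lambda>x. w \<in> D x)"
      "\<And>w w' k. Measurable.pred M (\<lambda>x. N x w w' k)"
      "\<And>w. Measurable.pred M (\<lambda>x. w \<in> D' x)"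
      "\<And>w w' k. Measurable.pred M (\<lambda>x. N' x w w' k)"
  shows "Measurable.pred M (\<lambda>x. coarse_match l (D x) (N x) (D' x) (N' x))"
proof -
  define V where "V = (\<lambda>C J. \<Union>(w, w', k::nat)\<in>J. {v. v = w \<or> v = w' \<or> l v \<le> C * l w + C})"
  have [measurable]: "Measurable.pred M (\<lambda>x. match_at l C (D x) (N x) (D' x) (N' x) f w w' k)"
    for C f w w' k
    unfolding match_at_def by measurable
  have "finite (V C J)" if "finite J" for C J
  proof -
    have "finite {v. v = w \<or> v = w' \<or> l v \<le> C * l w + C}" for w w'
      using fin[of "C * l w + C"] by (simp add: Collect_disj_eq)
    then show ?thesis unfolding V_def using that by auto
  qed
  then have "finite (PiE (V C J) (\<lambda>w. {v. l v \<le> C * l w + C}))" if "finite J" for C J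
    using that fin by (intro finite_PiE) auto
  then have "Measurable.pred M (\<lambda>x. \<exists>C. \<forall>js. \<exists>f\<in>PiE (V C (set js)) (\<lambda>w. {v. l v \<le> C * l w + C}).
        \<forall>i\<in>set js. match_at l C (D x) (N x) (D' x) (N' x) f (fst i) (fst (snd i)) (snd (snd i)))"
    by (intro pred_intros_countable pred_intros_finite(3,4)) auto
  then show ?thesis
    unfolding coarse_match_iff_finite[OF fin] V_def by (simp add: case_prod_beta)
qed


text \<open>Points are coded by words; \<open>N w w' k\<close> is a combinatorial substitute for
  \<open>d (s w) (s w') \<le> k\<close>, correct up to affine distortion.\<close>

locale coarse_coding = Metric_space M d
  for M :: "'m set" and d +
  fixes a :: real and l :: "'w \<Rightarrow> nat" and p :: 'm and D :: "'w set" and s :: "'w \<Rightarrow> 'm"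
    and N :: "'w \<Rightarrow> 'w \<Rightarrow> nat \<Rightarrow> bool"
  assumes a1: "1 \<le> a"
    and base: "p \<in> M"
    and point: "\<And>w. w \<in> D \<Longrightarrow> s w \<in> M"
    and dist_base: "\<And>w. w \<in> D \<Longrightarrow> d p (s w) \<le> a * l w"
    and dense: "\<And>q. q \<in> M \<Longrightarrow> \<exists>w\<in>D. d (s w) q \<le> a \<and> l w \<le> a * d p q"
    and near: "\<And>w w' k. w \<in> D \<Longrightarrow> w' \<in> D \<Longrightarrow> N w w' k \<Longrightarrow> d (s w) (s w') \<le> a * k + a"
    and nearI: "\<And>w w' k. w \<in> D \<Longrightarrow> w' \<in> D \<Longrightarrow> d (s w) (s w') \<le> real k \<Longrightarrow> N w w' k"
begin

lemma triangle4:
  assumes "x \<in> M" "x' \<in> M" "y' \<in> M" "y \<in> M"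
  shows "d x y \<le> d x x' + d x' y' + d y' y"
  using triangle[of x x' y] triangle[of x' y' y] assms by linarith

end

section \<open>Coarse matchings and coarse quasi-isometries are equivalent\<close>

text \<open>Each estimate below has its own real constants, while a matching has one natural
  constant; the constants are collected in a list and bounded together.\<close>

lemma nat_upper_bound:
  obtains c :: nat where "\<And>q. q \<in> set (qs :: real list) \<Longrightarrow> q \<le> real c"
proof -
  obtain c :: nat where "sum_list (map abs qs) \<le> real c" using real_arch_simple by blast
  moreover have "q \<le> sum_list (map abs qs)" if "q \<in> set qs" for q
    using member_le_sum_list[of "\<bar>q\<bar>" "map abs qs"] that by force
  ultimately show thesis using that by (meson order_trans)
qed

lemma affine_mono:
  fixes m b c t :: real
  assumes "x \<le> m * t + b" "m \<le> c" "b \<le> c" "0 \<le> t"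
  shows "x \<le> c * t + c"
  using assms mult_right_mono[of m c t] by linarith

text \<open>A word \<open>w\<close> is decoded to \<open>s w\<close>, moved to a net point
  \<alpha>\<open>w\<close>, sent through \<open>f\<close>, and encoded again by \<beta>. Every
  replacement moves a point by at most \<open>K\<close> or \<open>a\<close>, so distances survive up
  to affine distortion. Lengths are controlled through distances to the base points.\<close>

lemma coarse_match_if_coarsely_quasi_isometric:
  assumes "coarse_coding M d a l p D s N" "coarse_coding M' d' a l p' D' s' N'"
    and "coarsely_quasi_isometric M d M' d'"
  shows "coarse_match l D N D' N'"
proof -
  interpret M: coarse_coding M d a l p D s N by fact
  interpret M': coarse_coding M' d' a l p' D' s' N' by fact
  obtain K C A A' f where K: "K \<ge> 0" and C: "C \<ge> 1" and netA: "is_net K M d A"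
    and netA': "is_net K M' d' A'" and f: "bij_betw f A A'"
    and lo: "\<And>x y. x \<in> A \<Longrightarrow> y \<in> A \<Longrightarrow> 1 / C * d x y \<le> d' (f x) (f y)"
    and up: "\<And>x y. x \<in> A \<Longrightarrow> y \<in> A \<Longrightarrow> d' (f x) (f y) \<le> C * d x y"
    using assms(3) unfolding coarsely_quasi_isometric_def coarse_quasi_isometry_def by blast
  have A: "A \<subseteq> M" and A': "A' \<subseteq> M'" using netA netA' by (auto simp: is_net_def)
  have fA: "f x \<in> M'" if "x \<in> A" for x using f A' that by (auto simp: bij_betw_def)
  have lo': "d x y \<le> C * d' (f x) (f y)" if "x \<in> A" "y \<in> A" for x y
    using lo[OF that] C by (simp add: field_simps)
  have Cmono: "C * x \<le> C * y" if "x \<le> y" for x y :: real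
    using that C by (simp add: mult_left_mono)
  have amono: "a * x \<le> a * y" if "x \<le> y" for x y :: real
    using that M.a1 by (simp add: mult_left_mono)
  have "\<forall>w\<in>D. \<exists>b\<in>A. d (s w) b \<le> K"
    using netA M.point unfolding is_net_def by blast
  then obtain \<alpha> where \<alpha>: "\<And>w. w \<in> D \<Longrightarrow> \<alpha> w \<in> A" "\<And>w. w \<in> D \<Longrightarrow> d (s w) (\<alpha> w) \<le> K"
    by metis
  obtain \<beta> where \<beta>: "\<And>q. q \<in> M' \<Longrightarrow> \<beta> q \<in> D'" "\<And>q. q \<in> M' \<Longrightarrow> d' (s' (\<beta> q)) q \<le> a"
      "\<And>q. q \<in> M' \<Longrightarrow> l (\<beta> q) \<le> a * d' p' q"
    using M'.dense by metis
  obtain b0 where b0: "b0 \<in> A" using netA M.base unfolding is_net_def by blast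
  \<comment> \<open>The base points need not correspond under \<open>f\<close>; \<open>e0\<close>
    and \<open>e\<close> measure the detours through a net point \<open>b0\<close> and its
    image.\<close>
  define e where "e = d' p' (f b0)"
  define e0 where "e0 = d p b0"
  \<comment> \<open>The default \<beta>\<open>p'\<close> has length 0, because
    \<open>d' p' p' = 0\<close>, so the length bound also holds outside \<open>D\<close>.\<close>
  define g where "g = (\<lambda>w. if w \<in> D then \<beta> (f (\<alpha> w)) else \<beta> p')"
  have gD: "g w = \<beta> (f (\<alpha> w))" if "w \<in> D" for w using that by (simp add: g_def)
  have gM: "g w \<in> D'" if "w \<in> D" for w using that \<alpha> \<beta> fA gD by metis
  \<comment> \<open>The slopes, intercepts and bounds arising in \<open>length_g\<close>,
    \<open>forth\<close>, \<open>pull\<close> and \<open>onto\<close>, in this order;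
    \<open>forth\<close> and \<open>pull\<close> share the slope \<open>C * a\<close>.\<close>
  define qs where "qs = [a * (C * a), a * (e + C * (e0 + K)), C * a, C * (a + 2 * K) + 2 * a,
      C * (3 * a) + 2 * K, a * (C * a), a * (e0 + C * (e + K)), a + C * (K + a) + K, 0]"
  obtain c :: nat where c: "\<And>q. q \<in> set qs \<Longrightarrow> q \<le> real c" using nat_upper_bound[of qs] by blast
  note c' = c[unfolded qs_def]
  have length_g: "l (g w) \<le> c * l w + c" for w
  proof (cases "w \<in> D")
    case True
    have "d' p' (f (\<alpha> w)) \<le> d' p' (f b0) + d' (f b0) (f (\<alpha> w))"
      using True \<alpha> fA b0 M'.base by (intro M'.triangle) auto
    moreover have "d' (f b0) (f (\<alpha> w)) \<le> C * d b0 (\<alpha> w)" using True \<alpha> b0 up by blast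
    moreover have "d b0 (\<alpha> w) \<le> d b0 p + d p (s w) + d (s w) (\<alpha> w)"
      using True \<alpha> b0 A M.base M.point by (intro M.triangle4) auto
    then have "d b0 (\<alpha> w) \<le> e0 + a * l w + K"
      using M.dist_base[OF True] \<alpha>(2)[OF True] by (simp add: e0_def M.commute)
    then have "C * d b0 (\<alpha> w) \<le> C * (e0 + a * l w + K)" by (rule Cmono)
    ultimately have "d' p' (f (\<alpha> w)) \<le> e + C * (e0 + a * l w + K)" by (simp add: e_def)
    then have "a * d' p' (f (\<alpha> w)) \<le> a * (e + C * (e0 + a * l w + K))" by (rule amono)
    moreover have "l (g w) \<le> a * d' p' (f (\<alpha> w))" using \<beta>(3) True gD \<alpha> fA by metis
    ultimately have "l (g w) \<le> (a * (C * a)) * l w + a * (e + C * (e0 + K))"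
      by (simp add: algebra_simps)
    then have "real (l (g w)) \<le> c * real (l w) + c" by (rule affine_mono) (use c' in auto)
    then show ?thesis by (metis of_nat_add of_nat_le_iff of_nat_mult)
  next
    case False
    have "l (\<beta> p') \<le> a * d' p' p'" using \<beta>(3) M'.base by blast
    then have "l (\<beta> p') = 0" using M'.base by simp
    then show ?thesis using False by (simp add: g_def)
  qed
  have forth: "N' (g w) (g w') (c * k + c)" if "w \<in> D" "w' \<in> D" "N w w' k" for w w' k
  proof -
    have "d (\<alpha> w) (\<alpha> w') \<le> d (\<alpha> w) (s w) + d (s w) (s w') + d (s w') (\<alpha> w')"
      using that \<alpha> A M.point by (intro M.triangle4) auto
    then have "d (\<alpha> w) (\<alpha> w') \<le> a * k + a + 2 * K"
      using \<alpha>(2)[of w] \<alpha>(2)[of w'] M.near[OF that] that by (simp add: M.commute)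
    then have "C * d (\<alpha> w) (\<alpha> w') \<le> C * (a * k + a + 2 * K)" by (rule Cmono)
    then have 1: "d' (f (\<alpha> w)) (f (\<alpha> w')) \<le> C * (a * k + a + 2 * K)"
      using up[of "\<alpha> w" "\<alpha> w'"] \<alpha> that by fastforce
    have "d' (s' (g w)) (s' (g w')) \<le> d' (s' (g w)) (f (\<alpha> w)) + d' (f (\<alpha> w)) (f (\<alpha> w'))
        + d' (f (\<alpha> w')) (s' (g w'))"
      using that \<alpha> fA gM M'.point by (intro M'.triangle4) auto
    then have "d' (s' (g w)) (s' (g w')) \<le> (C * a) * k + (C * (a + 2 * K) + 2 * a)"
      using 1 \<beta>(2)[of "f (\<alpha> w)"] \<beta>(2)[of "f (\<alpha> w')"] fA \<alpha> that gD
      by (simp add: M'.commute algebra_simps)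
    then have "d' (s' (g w)) (s' (g w')) \<le> c * real k + c"
      by (rule affine_mono) (use c' in auto)
    then show ?thesis using that gM by (intro M'.nearI) auto
  qed
  have pull: "N w w' (c * k + c)" if "w \<in> D" "w' \<in> D" "N' (g w) (g w') k" for w w' k
  proof -
    have "d' (f (\<alpha> w)) (f (\<alpha> w')) \<le> d' (f (\<alpha> w)) (s' (g w)) + d' (s' (g w)) (s' (g w'))
        + d' (s' (g w')) (f (\<alpha> w'))"
      using that \<alpha> fA gM M'.point by (intro M'.triangle4) auto
    moreover have "d' (s' (g w)) (s' (g w')) \<le> a * k + a"
      using that gM by (intro M'.near) auto
    ultimately have "d' (f (\<alpha> w)) (f (\<alpha> w')) \<le> a * k + 3 * a"
      using \<beta>(2)[of "f (\<alpha> w)"] \<beta>(2)[of "f (\<alpha> w')"] fA \<alpha> that gD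
      by (simp add: M'.commute algebra_simps)
    then have "C * d' (f (\<alpha> w)) (f (\<alpha> w')) \<le> C * (a * k + 3 * a)" by (rule Cmono)
    then have 1: "d (\<alpha> w) (\<alpha> w') \<le> C * (a * k + 3 * a)"
      using lo'[of "\<alpha> w" "\<alpha> w'"] \<alpha> that by fastforce
    have "d (s w) (s w') \<le> d (s w) (\<alpha> w) + d (\<alpha> w) (\<alpha> w') + d (\<alpha> w') (s w')"
      using that \<alpha> A M.point by (intro M.triangle4) auto
    then have "d (s w) (s w') \<le> (C * a) * k + (C * (3 * a) + 2 * K)"
      using 1 \<alpha>(2)[of w] \<alpha>(2)[of w'] that by (simp add: M.commute algebra_simps)
    then have "d (s w) (s w') \<le> c * real k + c"
      by (rule affine_mono) (use c' in auto)
    then show ?thesis using that by (intro M.nearI) auto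
  qed
  \<comment> \<open>The witness \<open>v\<close> codes a point near \<open>b\<close>, where
    \<open>f b\<close> is a net point near \<open>s' u\<close>. Its length is bounded by pulling the
    distance from \<open>f b0\<close> to \<open>f b\<close> back through the lower bound on
    \<open>f\<close>.\<close>
  have onto: "\<exists>v. l v \<le> c * l u + c \<and> v \<in> D \<and> N' (g v) u c" if u: "u \<in> D'" for u
  proof -
    obtain b' where b': "b' \<in> A'" "d' (s' u) b' \<le> K"
      using netA' M'.point[OF u] unfolding is_net_def by blast
    then obtain b where b: "b \<in> A" "f b = b'" using f by (auto simp: bij_betw_def)
    obtain v where v: "v \<in> D" "d (s v) b \<le> a" "l v \<le> a * d p b"
      using M.dense b A by blast
    have "d p b \<le> d p b0 + d b0 b" using M.base b b0 A by (intro M.triangle) auto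
    moreover have "d b0 b \<le> C * d' (f b0) (f b)" using b b0 by (intro lo')
    moreover have "d' (f b0) (f b) \<le> d' (f b0) p' + d' p' (s' u) + d' (s' u) (f b)"
      using b b0 fA M'.base M'.point u by (intro M'.triangle4) auto
    then have "d' (f b0) (f b) \<le> e + a * l u + K"
      using M'.dist_base[OF u] b' b by (simp add: e_def M'.commute)
    then have "C * d' (f b0) (f b) \<le> C * (e + a * l u + K)" by (rule Cmono)
    ultimately have "d p b \<le> e0 + C * (e + a * l u + K)" by (simp add: e0_def)
    then have "a * d p b \<le> a * (e0 + C * (e + a * l u + K))" by (rule amono)
    then have "l v \<le> (a * (C * a)) * l u + a * (e0 + C * (e + K))"
      using v(3) by (simp add: algebra_simps)
    then have "real (l v) \<le> c * real (l u) + c" by (rule affine_mono) (use c' in auto)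
    then have 1: "l v \<le> c * l u + c" by (metis of_nat_add of_nat_le_iff of_nat_mult)
    have "d (\<alpha> v) b \<le> d (\<alpha> v) (s v) + d (s v) b"
      using v \<alpha> b A M.point by (intro M.triangle) auto
    then have "d (\<alpha> v) b \<le> K + a" using v \<alpha>(2)[of v] by (simp add: M.commute)
    then have "C * d (\<alpha> v) b \<le> C * (K + a)" by (rule Cmono)
    then have 2: "d' (f (\<alpha> v)) b' \<le> C * (K + a)" using up[of "\<alpha> v" b] \<alpha> v b by fastforce
    have "d' (s' (g v)) (s' u) \<le> d' (s' (g v)) (f (\<alpha> v)) + d' (f (\<alpha> v)) b' + d' b' (s' u)"
      using v \<alpha> fA b' A' gM u M'.point by (intro M'.triangle4) auto
    then have "d' (s' (g v)) (s' u) \<le> a + C * (K + a) + K"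
      using 2 b' \<beta>(2)[of "f (\<alpha> v)"] fA \<alpha> v gD by (simp add: M'.commute)
    then have "d' (s' (g v)) (s' u) \<le> c" using c'[of "a + C * (K + a) + K"] by simp
    then have "N' (g v) u c" using v gM u by (intro M'.nearI) auto
    with 1 v show ?thesis by blast
  qed
  show ?thesis
    unfolding coarse_match_def match_at_def
    using length_g forth pull onto gM by blast
qed

text \<open>The map \<open>F\<close> encodes a point approximately by \<gamma>, applies the matching
  to the code and decodes. It need not be injective; the passage to a separated net takes care of
  that.\<close>

lemma coarsely_quasi_isometric_if_coarse_match:
  assumes "coarse_coding M d a l p D s N" "coarse_coding M' d' a l p' D' s' N'"
    and "coarse_match l D N D' N'"
  shows "coarsely_quasi_isometric M d M' d'"
proof -
  interpret M: coarse_coding M d a l p D s N by fact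
  interpret M': coarse_coding M' d' a l p' D' s' N' by fact
  obtain c f where match: "\<And>w w' k. match_at l c D N D' N' f w w' k"
    using assms(3) unfolding coarse_match_def by blast
  have fD: "f w \<in> D'" if "w \<in> D" for w
    using match[of w w 0] that by (simp add: match_at_def)
  have forth: "N' (f w) (f w') (c * k + c)" if "w \<in> D" "w' \<in> D" "N w w' k" for w w' k
    using match[of w w' k] that by (simp add: match_at_def)
  have pull: "N w w' (c * k + c)" if "w \<in> D" "w' \<in> D" "N' (f w) (f w') k" for w w' k
    using match[of w w' k] that by (simp add: match_at_def)
  have onto: "\<exists>v\<in>D. N' (f v) u c" if "u \<in> D'" for u
    using match[of u u 0] that by (auto simp: match_at_def)
  obtain \<gamma> where \<gamma>: "\<And>q. q \<in> M \<Longrightarrow> \<gamma> q \<in> D" "\<And>q. q \<in> M \<Longrightarrow> d (s (\<gamma> q)) q \<le> a"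
    using M.dense by metis
  have acmono: "a * (c * x) \<le> a * (c * y)" if "x \<le> y" for x y :: real
    using that M.a1 by (simp add: mult_left_mono)
  have forth': "d' (s' (f w)) (s' (f w')) \<le> a * (c * (r + 1) + c) + a"
    if "w \<in> D" "w' \<in> D" "d (s w) (s w') \<le> r" for w w' and r :: real
  proof -
    \<comment> \<open>The relations \<open>N\<close> and \<open>N'\<close> see only integer
      distances. Rounding up is the origin of \<open>r + 1\<close> in the bound.\<close>
    define k :: nat where "k = nat \<lceil>r\<rceil>"
    have "r \<ge> 0" using that(3) M.nonneg order_trans by blast
    then have k: "r \<le> k" "k \<le> r + 1" by (simp_all add: k_def)
    have "d (s w) (s w') \<le> k" using that k by linarith
    then have "N w w' k" using that by (intro M.nearI)
    then have "N' (f w) (f w') (c * k + c)" using that forth by blast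
    then have "d' (s' (f w)) (s' (f w')) \<le> a * (c * k + c) + a"
      using M'.near[of "f w" "f w'" "c * k + c"] fD that by simp
    also have "\<dots> \<le> a * (c * (r + 1) + c) + a"
      using acmono[OF k(2)] by (simp add: algebra_simps)
    finally show ?thesis .
  qed
  have pull': "d (s w) (s w') \<le> a * (c * (r + 1) + c) + a"
    if "w \<in> D" "w' \<in> D" "d' (s' (f w)) (s' (f w')) \<le> r" for w w' and r :: real
  proof -
    define k :: nat where "k = nat \<lceil>r\<rceil>"
    have "r \<ge> 0" using that(3) M'.nonneg order_trans by blast
    then have k: "r \<le> k" "k \<le> r + 1" by (simp_all add: k_def)
    have "d' (s' (f w)) (s' (f w')) \<le> k" using that k by linarith
    then have "N' (f w) (f w') k" using that fD by (intro M'.nearI) auto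
    then have "N w w' (c * k + c)" using that pull by blast
    then have "d (s w) (s w') \<le> a * (c * k + c) + a"
      using M.near[of w w' "c * k + c"] that by simp
    also have "\<dots> \<le> a * (c * (r + 1) + c) + a"
      using acmono[OF k(2)] by (simp add: algebra_simps)
    finally show ?thesis .
  qed
  define F where "F = (\<lambda>q. s' (f (\<gamma> q)))"
  have FM: "F q \<in> M'" if "q \<in> M" for q using that \<gamma> fD M'.point by (simp add: F_def)
  \<comment> \<open>The slopes and intercepts of the two distance estimates, which share the slope
    \<open>a * c\<close>, then the bound for coarse surjectivity; the entry 1 ensures
    \<open>1\<close> \<le> \<open>L\<close>.\<close>
  define qs where "qs = [a * c, a * (c * (2 * a + 1) + c) + a, a * (c + c) + 3 * a,
      a * (c * (a + 1) + c) + a + (a * c + a) + a, 1]"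
  obtain L :: nat where L: "\<And>q. q \<in> set qs \<Longrightarrow> q \<le> real L" using nat_upper_bound[of qs] by blast
  note L' = L[unfolded qs_def]
  show ?thesis
  proof (rule coarsely_quasi_isometric_if_quasi_isometry[where F = F and L = "real L"])
    show "Metric_space M d" "Metric_space M' d'" by unfold_locales
    show "1 \<le> real L" by (rule L') simp
    show "F q \<in> M'" if "q \<in> M" for q using FM that .
    show "d' (F x) (F y) \<le> L * d x y + L" if "x \<in> M" "y \<in> M" for x y
    proof -
      have "d (s (\<gamma> x)) (s (\<gamma> y)) \<le> d (s (\<gamma> x)) x + d x y + d y (s (\<gamma> y))"
        using that \<gamma> M.point by (intro M.triangle4) auto
      then have "d (s (\<gamma> x)) (s (\<gamma> y)) \<le> d x y + 2 * a"
        using \<gamma>(2)[OF that(1)] \<gamma>(2)[OF that(2)] by (simp add: M.commute)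
      then have "d' (F x) (F y) \<le> a * (c * (d x y + 2 * a + 1) + c) + a"
        unfolding F_def using that \<gamma> by (intro forth') auto
      then have "d' (F x) (F y) \<le> (a * c) * d x y + (a * (c * (2 * a + 1) + c) + a)"
        by (simp add: algebra_simps)
      then show ?thesis by (rule affine_mono) (use L' in auto)
    qed
    show "d x y \<le> L * d' (F x) (F y) + L" if "x \<in> M" "y \<in> M" for x y
    proof -
      have "d x y \<le> d x (s (\<gamma> x)) + d (s (\<gamma> x)) (s (\<gamma> y)) + d (s (\<gamma> y)) y"
        using that \<gamma> M.point by (intro M.triangle4) auto
      moreover have "d (s (\<gamma> x)) (s (\<gamma> y)) \<le> a * (c * (d' (F x) (F y) + 1) + c) + a"
        unfolding F_def using that \<gamma> by (intro pull') auto
      ultimately have "d x y \<le> (a * c) * d' (F x) (F y) + (a * (c + c) + 3 * a)"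
        using \<gamma>(2)[OF that(1)] \<gamma>(2)[OF that(2)] by (simp add: M.commute algebra_simps)
      then show ?thesis by (rule affine_mono) (use L' in auto)
    qed
    show "\<exists>x\<in>M. d' (F x) y \<le> L" if y: "y \<in> M'" for y
    proof -
      obtain u where u: "u \<in> D'" "d' (s' u) y \<le> a" using M'.dense y by blast
      then obtain v where v: "v \<in> D" "N' (f v) u c" using onto by blast
      have sv: "s v \<in> M" using v M.point by blast
      \<comment> \<open>\<gamma>\<open>(s v)\<close> need not be \<open>v\<close>, but both code
        points at distance at most \<open>a\<close>, so their images are close by
        \<open>forth'\<close> with \<open>r = a\<close>.\<close>
      have "d' (F (s v)) (s' (f v)) \<le> a * (c * (a + 1) + c) + a"
        unfolding F_def using v \<gamma> sv by (intro forth') auto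
      moreover have "d' (s' (f v)) (s' u) \<le> a * c + a"
        using v u fD by (intro M'.near) auto
      moreover have "d' (F (s v)) y \<le> d' (F (s v)) (s' (f v)) + d' (s' (f v)) (s' u) + d' (s' u) y"
        using sv FM fD v u y M'.point by (intro M'.triangle4) auto
      ultimately have "d' (F (s v)) y \<le> a * (c * (a + 1) + c) + a + (a * c + a) + a"
        using u by linarith
      also have "\<dots> \<le> L" by (rule L') simp
      finally show ?thesis using sv by blast
    qed
  qed
qed

lemma coarsely_quasi_isometric_iff_coarse_match:
  assumes "coarse_coding M d a l p D s N" "coarse_coding M' d' a l p' D' s' N'"
  shows "coarsely_quasi_isometric M d M' d' \<longleftrightarrow> coarse_match l D N D' N'"
  using assms coarse_match_if_coarsely_quasi_isometric coarsely_quasi_isometric_if_coarse_match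
  by metis


section \<open>Charts and plaques\<close>

definition chart_inv :: "('a, 'z) chart \<Rightarrow> (nat \<Rightarrow> real) \<times> 'z \<Rightarrow> 'a" where
  "chart_inv c = inv_into (dom_of c) (map_of_chart c)"

text \<open>With the ball coordinate \<open>b\<close> fixed, the result depends only on the plaque
  of \<open>q\<close>, and continuously on \<open>q\<close>.\<close>

definition slide :: "('a, 'z) chart \<Rightarrow> (nat \<Rightarrow> real) \<Rightarrow> 'a \<Rightarrow> 'a" where
  "slide c b q = chart_inv c (b, transverse_proj c q)"

text \<open>The equivalence relation whose classes are the plaques of the chart; chains of plaques
  become powers of a relation.\<close>

definition plaque_rel :: "('a, 'z) chart \<Rightarrow> 'a rel" where
  "plaque_rel c = {(p, q). p \<in> dom_of c \<and> q \<in> dom_of c \<and> transverse_proj c p = transverse_proj c q}"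

lemma is_open_ball_subset: "is_open_ball n B \<Longrightarrow> B \<subseteq> topspace (Euclidean_space n)"
  by (auto simp: is_open_ball_def)

lemma is_open_ball_nonempty:
  assumes "is_open_ball n B"
  shows "\<exists>b. b \<in> B"
proof -
  obtain a r where a: "a \<in> topspace (Euclidean_space n)" "0 < r"
    "B = {x \<in> topspace (Euclidean_space n). L2_set (\<lambda>i. x i - a i) {..<n} < r}"
    using assms unfolding is_open_ball_def by blast
  have "L2_set (\<lambda>i. a i - a i) {..<n} = 0" by (simp add: L2_set_def)
  then show ?thesis using a by auto
qed

text \<open>The ball is the union of the segments \<gamma>\<open>x\<close> from its center
  \<open>a\<close>, which are connected and share \<open>a\<close>. Points of
  \<open>Euclidean_space n\<close> are sequences vanishing from index \<open>n\<close> on, and the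
  segments inherit this.\<close>

lemma connectedin_open_ball:
  assumes "is_open_ball n B"
  shows "connectedin (Euclidean_space n) B"
proof -
  obtain a r where a: "a \<in> topspace (Euclidean_space n)" "0 < r"
    and B: "B = {x \<in> topspace (Euclidean_space n). L2_set (\<lambda>i. x i - a i) {..<n} < r}"
    using assms unfolding is_open_ball_def by blast
  define \<gamma> where "\<gamma> = (\<lambda>x (t::real) i. a i + t * (x i - a i))"
  have a0: "a i = 0" if "i \<ge> n" for i using a(1) that by (simp add: topspace_Euclidean_space)
  have \<gamma>: "connectedin (Euclidean_space n) (\<gamma> x ` {0..1})" "\<gamma> x ` {0..1} \<subseteq> B"
    "a \<in> \<gamma> x ` {0..1}" "x \<in> \<gamma> x ` {0..1}" if x: "x \<in> B" for x
  proof -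
    have x0: "x i = 0" if "i \<ge> n" for i using x that by (simp add: B topspace_Euclidean_space)
    have "continuous_map euclideanreal (Euclidean_space n) (\<gamma> x)"
      unfolding Euclidean_space_def continuous_map_in_subtopology \<gamma>_def
      by (auto simp: continuous_map_componentwise_UNIV a0 x0 intro!: continuous_intros)
    then show "connectedin (Euclidean_space n) (\<gamma> x ` {0..1})"
      by (rule connectedin_continuous_map_image) (simp add: connectedin_iff_connected)
    show "\<gamma> x ` {0..1} \<subseteq> B"
    proof (clarify)
      fix t :: real assume t: "t \<in> {0..1}"
      have "L2_set (\<lambda>i. \<gamma> x t i - a i) {..<n} = t * L2_set (\<lambda>i. x i - a i) {..<n}"
        using t by (simp add: \<gamma>_def L2_set_right_distrib)
      also have "\<dots> \<le> 1 * L2_set (\<lambda>i. x i - a i) {..<n}"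
        using t by (intro mult_right_mono) auto
      also have "\<dots> < r" using x by (simp add: B)
      finally show "\<gamma> x t \<in> B"
        by (simp add: B topspace_Euclidean_space \<gamma>_def a0 x0)
    qed
    show "a \<in> \<gamma> x ` {0..1}" by (rule image_eqI[of _ _ 0]) (auto simp: \<gamma>_def)
    show "x \<in> \<gamma> x ` {0..1}" by (rule image_eqI[of _ _ 1]) (auto simp: \<gamma>_def)
  qed
  have "connectedin (Euclidean_space n) (\<Union>x\<in>B. \<gamma> x ` {0..1})"
  proof (rule connectedin_Union)
    have "a \<in> (\<Inter>x\<in>B. \<gamma> x ` {0..1})" using \<gamma>(3) by blast
    then show "(\<Inter>x\<in>B. \<gamma> x ` {0..1}) \<noteq> {}" by blast
  qed (use \<gamma>(1) in blast)
  moreover have "(\<Union>x\<in>B. \<gamma> x ` {0..1}) = B"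
  proof (rule equalityI)
    show "(\<Union>x\<in>B. \<gamma> x ` {0..1}) \<subseteq> B" using \<gamma>(2) by (rule UN_least)
    show "B \<subseteq> (\<Union>x\<in>B. \<gamma> x ` {0..1})" using \<gamma>(4) by (intro subsetI UN_I)
  qed
  ultimately show ?thesis by simp
qed

context
  fixes n X and c :: "('a, 'z) chart"
  assumes c: "is_chart n X c"
begin

private abbreviation (input) "T \<equiv>
  prod_topology (subtopology (Euclidean_space n) (ball_of c)) (trans_of c)"

lemma openin_dom_of: "openin X (dom_of c)"
  using c by (simp add: is_chart_def)

lemma dom_of_subset: "dom_of c \<subseteq> topspace X"
  using openin_dom_of openin_subset by blast

lemma topspace_chart_codomain: "topspace T = ball_of c \<times> topspace (trans_of c)"
  using c is_open_ball_subset by (fastforce simp: is_chart_def)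

lemma homeomorphic_chart: "homeomorphic_map (subtopology X (dom_of c)) T (map_of_chart c)"
  using c by (simp add: is_chart_def)

lemma map_of_chart_in:
  assumes "q \<in> dom_of c"
  shows "map_of_chart c q \<in> ball_of c \<times> topspace (trans_of c)"
  using homeomorphic_imp_surjective_map[OF homeomorphic_chart] assms dom_of_subset
  unfolding topspace_chart_codomain by auto

lemma transverse_proj_in: "q \<in> dom_of c \<Longrightarrow> transverse_proj c q \<in> topspace (trans_of c)"
  using map_of_chart_in by (auto simp: transverse_proj_def mem_Times_iff)

lemma homeomorphic_maps_chart_inv:
  "homeomorphic_maps (subtopology X (dom_of c)) T (map_of_chart c) (chart_inv c)"
proof -
  obtain g where g: "homeomorphic_maps (subtopology X (dom_of c)) T (map_of_chart c) g"
    using homeomorphic_chart homeomorphic_map_maps by blast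
  have top: "topspace (subtopology X (dom_of c)) = dom_of c" using dom_of_subset by auto
  have inj: "inj_on (map_of_chart c) (dom_of c)"
    using homeomorphic_imp_injective_map[OF homeomorphic_chart] top by simp
  have "chart_inv c y = g y" if "y \<in> topspace T" for y
  proof -
    have "g y \<in> dom_of c" "map_of_chart c (g y) = y"
      using g that top by (auto simp: homeomorphic_maps_def continuous_map_def)
    then show ?thesis using inv_into_f_f[OF inj, of "g y"] by (simp add: chart_inv_def)
  qed
  then show ?thesis using homeomorphic_maps_eq[OF g] by metis
qed

lemma chart_inv:
  assumes "b \<in> ball_of c" "z \<in> topspace (trans_of c)"
  shows "chart_inv c (b, z) \<in> dom_of c" "map_of_chart c (chart_inv c (b, z)) = (b, z)"
    "transverse_proj c (chart_inv c (b, z)) = z"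
proof -
  have "(b, z) \<in> topspace T" using assms topspace_chart_codomain by simp
  then show "chart_inv c (b, z) \<in> dom_of c" "map_of_chart c (chart_inv c (b, z)) = (b, z)"
    using homeomorphic_maps_chart_inv unfolding homeomorphic_maps_def continuous_map_def by auto
  then show "transverse_proj c (chart_inv c (b, z)) = z" by (simp add: transverse_proj_def)
qed

lemma chart_inv_map_of_chart: "q \<in> dom_of c \<Longrightarrow> chart_inv c (map_of_chart c q) = q"
  using homeomorphic_maps_chart_inv dom_of_subset unfolding homeomorphic_maps_def by auto

lemma continuous_map_transverse_proj:
  "continuous_map (subtopology X (dom_of c)) (trans_of c) (transverse_proj c)"
  using continuous_map_compose[OF homeomorphic_imp_continuous_map[OF homeomorphic_chart]
      continuous_map_snd]
  by (simp add: transverse_proj_def[abs_def] o_def)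

lemma continuous_map_chart_inv: "continuous_map T X (chart_inv c)"
  using homeomorphic_maps_chart_inv continuous_map_into_fulltopology
  unfolding homeomorphic_maps_def by blast

lemma slide:
  assumes "b \<in> ball_of c" "q \<in> dom_of c"
  shows "slide c b q \<in> dom_of c" "transverse_proj c (slide c b q) = transverse_proj c q"
  using chart_inv[OF assms(1) transverse_proj_in[OF assms(2)]] by (simp_all add: slide_def)

lemma slide_self:
  assumes "(q, r) \<in> plaque_rel c"
  shows "fst (map_of_chart c r) \<in> ball_of c" "slide c (fst (map_of_chart c r)) q = r"
proof -
  have r: "r \<in> dom_of c" "transverse_proj c q = snd (map_of_chart c r)"
    using assms by (auto simp: plaque_rel_def transverse_proj_def)
  show "fst (map_of_chart c r) \<in> ball_of c" using map_of_chart_in r by fastforce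
  show "slide c (fst (map_of_chart c r)) q = r"
    using r chart_inv_map_of_chart by (simp add: slide_def)
qed

lemma openin_slide_preimage:
  assumes "b \<in> ball_of c" "openin X V"
  shows "openin X {q \<in> dom_of c. slide c b q \<in> V}"
proof -
  have "b \<in> topspace (subtopology (Euclidean_space n) (ball_of c))"
    using assms(1) c is_open_ball_subset by (fastforce simp: is_chart_def)
  then have "continuous_map (subtopology X (dom_of c)) T (\<lambda>q. (b, transverse_proj c q))"
    by (intro continuous_map_pairedI continuous_map_transverse_proj) simp
  from continuous_map_compose[OF this continuous_map_chart_inv]
  have "continuous_map (subtopology X (dom_of c)) X (slide c b)"
    by (simp add: slide_def[abs_def] o_def)
  from openin_continuous_map_preimage[OF this assms(2)]
  have "openin (subtopology X (dom_of c)) {q \<in> dom_of c. slide c b q \<in> V}"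
    using dom_of_subset by (simp add: Int_absorb1)
  then show ?thesis using openin_dom_of openin_trans_full by blast
qed

lemma openin_transverse_preimage:
  assumes "openin (trans_of c) W"
  shows "openin X {q \<in> dom_of c. transverse_proj c q \<in> W}"
proof -
  have "openin (subtopology X (dom_of c)) {q \<in> dom_of c. transverse_proj c q \<in> W}"
    using openin_continuous_map_preimage[OF continuous_map_transverse_proj assms] dom_of_subset
    by (simp add: Int_absorb1)
  then show ?thesis using openin_dom_of openin_trans_full by blast
qed

lemma Hausdorff_trans_of: "Hausdorff_space (trans_of c)"
  using c completely_metrizable_imp_metrizable_space metrizable_imp_Hausdorff_space
  unfolding is_chart_def Polish_top_def by blast

lemma plaques_eq:
  "plaques c = (\<lambda>z. {q \<in> dom_of c. transverse_proj c q = z}) ` topspace (trans_of c)"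
proof -
  have "{q \<in> dom_of c. map_of_chart c q \<in> ball_of c \<times> {z}} = {q \<in> dom_of c. transverse_proj c q = z}"
    for z
    using map_of_chart_in by (fastforce simp: transverse_proj_def mem_Times_iff)
  then show ?thesis by (auto simp: plaques_def)
qed

lemma plaque_in_plaques: "q \<in> dom_of c \<Longrightarrow> plaque_rel c `` {q} \<in> plaques c"
  unfolding plaques_eq by (rule image_eqI[OF _ transverse_proj_in]) (auto simp: plaque_rel_def)

lemma plaque_eq_Image:
  assumes "P \<in> plaques c" "q \<in> P"
  shows "q \<in> dom_of c" "P = plaque_rel c `` {q}"
  using assms by (auto simp: plaques_eq plaque_rel_def)

lemma plaque_nonempty:
  assumes "P \<in> plaques c"
  shows "P \<noteq> {}"
proof -
  obtain z where "z \<in> topspace (trans_of c)" "P = {q \<in> dom_of c. transverse_proj c q = z}"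
    using assms by (auto simp: plaques_eq)
  moreover obtain b where "b \<in> ball_of c" using c is_open_ball_nonempty by (auto simp: is_chart_def)
  ultimately show ?thesis using chart_inv by blast
qed

end

lemma foliated_changeD:
  assumes "foliated_change X c d" "p \<in> dom_of c" "p \<in> dom_of d"
  obtains W h where "openin X W" "p \<in> W" "W \<subseteq> dom_of c \<inter> dom_of d"
    "\<And>q. q \<in> W \<Longrightarrow> transverse_proj d q = h (transverse_proj c q)"
proof -
  have "p \<in> dom_of c \<inter> dom_of d" using assms by blast
  from bspec[OF assms(1)[unfolded foliated_change_def] this]
  obtain W g h where W: "openin X W \<and> p \<in> W \<and> W \<subseteq> dom_of c \<inter> dom_of d \<and>
      (\<forall>q\<in>W. \<forall>x z. map_of_chart c q = (x, z) \<longrightarrow> map_of_chart d q = (g (x, z), h z))"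
    by (elim exE) (rule that)
  have "transverse_proj d q = h (transverse_proj c q)" if "q \<in> W" for q
  proof -
    have "map_of_chart c q = (fst (map_of_chart c q), snd (map_of_chart c q))" by simp
    then have "map_of_chart d q =
        (g (fst (map_of_chart c q), snd (map_of_chart c q)), h (snd (map_of_chart c q)))"
      using W that by blast
    then show ?thesis by (simp add: transverse_proj_def)
  qed
  then show thesis using that[of W h] W by blast
qed


section \<open>Leaves and leaf metrics as graphs of plaques\<close>

lemma LEAST_relpow:
  assumes "(x, y) \<in> E\<^sup>*"
  shows "(x, y) \<in> E ^^ (LEAST k. (x, y) \<in> E ^^ k)"
proof -
  obtain k where "(x, y) \<in> E ^^ k" using rtrancl_imp_relpow[OF assms] by blast
  then show ?thesis by (rule LeastI)
qed

locale regular_atlas =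
  fixes n :: nat and X :: "'a topology" and \<A> \<U> :: "('a, 'z) chart set"
  assumes compact_Polish: "compact_Polish_foliated_space n X \<A>"
    and regular: "regular_foliated_atlas n X \<A> \<U>"
begin

abbreviation (input) "leaf_top \<equiv> leaf_topology n X \<A>"

definition E :: "'a rel" where "E = (\<Union>c\<in>\<U>. plaque_rel c)"

definition leaf_plaques :: "'a set set" where "leaf_plaques = (\<Union>c\<in>\<U>. plaques c)"

lemma is_chart_foliated: "c \<in> foliated_charts n X \<A> \<Longrightarrow> is_chart n X c"
  by (simp add: foliated_charts_def foliated_atlas_def)

lemma \<U>_subset: "\<U> \<subseteq> foliated_charts n X \<A>"
  using regular by (simp add: regular_foliated_atlas_def)

lemma is_chart_\<U>: "c \<in> \<U> \<Longrightarrow> is_chart n X c"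
  using \<U>_subset is_chart_foliated by blast

lemma \<U>_covers: "(\<Union>c\<in>\<U>. dom_of c) = topspace X"
  using regular by (simp add: regular_foliated_atlas_def foliated_atlas_def)

lemma \<A>_covers: "(\<Union>c\<in>\<A>. dom_of c) = topspace X"
  using compact_Polish by (simp add: compact_Polish_foliated_space_def foliated_atlas_def)

text \<open>Membership in \<open>foliated_charts\<close> compares a chart with those of \<A> only,
  so the change from \<open>c\<close> to \<open>d\<close> is factored near \<open>p\<close> through
  a chart of \<A>.\<close>

lemma transverse_change:
  assumes c: "c \<in> foliated_charts n X \<A>" and d: "d \<in> foliated_charts n X \<A>"
    and p: "p \<in> dom_of c" "p \<in> dom_of d"
  obtains W where "openin X W" "p \<in> W" "W \<subseteq> dom_of c \<inter> dom_of d"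
    "\<And>q. q \<in> W \<Longrightarrow> transverse_proj c q = transverse_proj c p \<Longrightarrow>
       transverse_proj d q = transverse_proj d p"
proof -
  obtain a where a: "a \<in> \<A>" "p \<in> dom_of a"
    using \<A>_covers dom_of_subset[OF is_chart_foliated[OF c]] p by blast
  have "foliated_change X c a" "foliated_change X a d"
    using c d a(1) by (auto simp: foliated_charts_def foliated_atlas_def)
  obtain W1 h1 where 1: "openin X W1" "p \<in> W1" "W1 \<subseteq> dom_of c \<inter> dom_of a"
    "\<And>q. q \<in> W1 \<Longrightarrow> transverse_proj a q = h1 (transverse_proj c q)"
    using foliated_changeD[OF \<open>foliated_change X c a\<close> p(1) a(2)] by blast
  obtain W2 h2 where 2: "openin X W2" "p \<in> W2" "W2 \<subseteq> dom_of a \<inter> dom_of d"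
    "\<And>q. q \<in> W2 \<Longrightarrow> transverse_proj d q = h2 (transverse_proj a q)"
    using foliated_changeD[OF \<open>foliated_change X a d\<close> a(2) p(2)] by blast
  have eq: "transverse_proj d q = h2 (h1 (transverse_proj c q))" if "q \<in> W1 \<inter> W2" for q
    using 1(4) 2(4) that by simp
  show thesis
  proof (rule that[of "W1 \<inter> W2"])
    show "openin X (W1 \<inter> W2)" using 1(1) 2(1) by blast
    show "transverse_proj d q = transverse_proj d p"
      if "q \<in> W1 \<inter> W2" "transverse_proj c q = transverse_proj c p" for q
      using eq[of q] eq[of p] that 1(2) 2(2) by simp
  qed (use 1(2,3) 2(2,3) in auto)
qed

lemma openin_plaque: "c \<in> foliated_charts n X \<A> \<Longrightarrow> P \<in> plaques c \<Longrightarrow> openin leaf_top P"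
  unfolding leaf_topology_def by (rule topology_generated_by_Basis) blast

lemma plaque_subset: "c \<in> foliated_charts n X \<A> \<Longrightarrow> P \<in> plaques c \<Longrightarrow> P \<subseteq> topspace X"
  using plaques_eq[OF is_chart_foliated] dom_of_subset[OF is_chart_foliated] by fastforce

lemma topspace_leaf_topology: "topspace leaf_top = topspace X"
proof
  show "topspace leaf_top \<subseteq> topspace X"
    unfolding leaf_topology_def using plaque_subset by auto
  show "topspace X \<subseteq> topspace leaf_top"
  proof
    fix q assume "q \<in> topspace X"
    then obtain c where c: "c \<in> \<U>" "q \<in> dom_of c" using \<U>_covers by blast
    then have "plaque_rel c `` {q} \<in> plaques c" "q \<in> plaque_rel c `` {q}"
      using plaque_in_plaques[OF is_chart_\<U>] by (auto simp: plaque_rel_def)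
    then show "q \<in> topspace leaf_top"
      using openin_subset[OF openin_plaque] \<U>_subset c(1) by blast
  qed
qed

text \<open>The plaque is the image of the connected ball under \<open>j\<close>, which fixes the
  transverse coordinate \<open>z\<close>. Continuity of \<open>j\<close> into the finer leaf
  topology is checked on the generating plaques \<open>Q\<close>: near a point of \<open>Q\<close>,
  the change of charts keeps the transverse coordinate in \<open>d\<close> constant along
  \<open>j\<close>, so \<open>j\<close> stays in \<open>Q\<close>.\<close>

lemma connectedin_plaque:
  assumes c: "c \<in> foliated_charts n X \<A>" and P: "P \<in> plaques c"
  shows "connectedin leaf_top P"
proof -
  note ch = is_chart_foliated[OF c]
  let ?B = "subtopology (Euclidean_space n) (ball_of c)"
  obtain z where z: "z \<in> topspace (trans_of c)" and Pz: "P = {q \<in> dom_of c. transverse_proj c q = z}"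
    using P plaques_eq[OF ch] by auto
  define j where "j = (\<lambda>b. chart_inv c (b, z))"
  have ball: "is_open_ball n (ball_of c)" using ch by (simp add: is_chart_def)
  then have top: "topspace ?B = ball_of c" using is_open_ball_subset by fastforce
  have "continuous_map ?B
      (prod_topology ?B (trans_of c)) (\<lambda>b. (b, z))"
    using z by (intro continuous_map_pairedI) auto
  from continuous_map_compose[OF this continuous_map_chart_inv[OF ch]]
  have j: "continuous_map ?B X j" by (simp add: j_def o_def)
  have jP: "j b \<in> P" if "b \<in> ball_of c" for b
    using chart_inv[OF ch that z] by (simp add: j_def Pz)
  have "continuous_map ?B leaf_top j"
    unfolding leaf_topology_def
  proof (rule continuous_on_generated_topo)
    show "j ` topspace ?B \<subseteq> \<Union> (\<Union> (plaques ` foliated_charts n X \<A>))"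
      using jP P c top by blast
    fix Q assume "Q \<in> (\<Union> (plaques ` foliated_charts n X \<A>))"
    then obtain d where d: "d \<in> foliated_charts n X \<A>" "Q \<in> plaques d" by blast
    show "openin ?B (j -` Q \<inter> topspace ?B)"
    proof (subst openin_subopen, intro ballI)
      fix b assume "b \<in> j -` Q \<inter> topspace ?B"
      then have b: "j b \<in> Q" "b \<in> ball_of c" using top by auto
      note jb = plaque_eq_Image[OF is_chart_foliated[OF d(1)] d(2) b(1)]
      have "j b \<in> dom_of c" using jP[OF b(2)] by (simp add: Pz)
      then obtain W where W: "openin X W" "j b \<in> W" "W \<subseteq> dom_of c \<inter> dom_of d"
        "\<And>q. q \<in> W \<Longrightarrow> transverse_proj c q = transverse_proj c (j b) \<Longrightarrow>
           transverse_proj d q = transverse_proj d (j b)"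
        using transverse_change[OF c d(1) _ jb(1)] by blast
      have sub: "j b' \<in> Q" if "b' \<in> ball_of c" "j b' \<in> W" for b'
      proof -
        have "transverse_proj c (j b') = transverse_proj c (j b)"
          using jP[OF that(1)] jP[OF b(2)] by (simp add: Pz)
        then have "transverse_proj d (j b') = transverse_proj d (j b)"
          using W(4) that by blast
        then show ?thesis using that W(3) jb by (auto simp: plaque_rel_def)
      qed
      have "openin ?B {b' \<in> topspace ?B. j b' \<in> W}"
        using openin_continuous_map_preimage[OF j W(1)] .
      moreover have "b \<in> {b' \<in> topspace ?B. j b' \<in> W}" using b top W(2) by auto
      moreover have "{b' \<in> topspace ?B. j b' \<in> W} \<subseteq> j -` Q \<inter> topspace ?B"
        using sub top by auto
      ultimately show "\<exists>S. openin ?B S \<and> b \<in> S \<and> S \<subseteq> j -` Q \<inter> topspace ?B" by blast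
    qed
  qed
  moreover have "connectedin ?B (ball_of c)"
    using connectedin_open_ball[OF ball] by (simp add: connectedin_subtopology)
  ultimately have "connectedin leaf_top (j ` ball_of c)" by (rule connectedin_continuous_map_image)
  moreover have "j ` ball_of c = P"
  proof
    show "P \<subseteq> j ` ball_of c"
    proof
      fix q assume "q \<in> P"
      then have q: "q \<in> dom_of c" "transverse_proj c q = z" by (auto simp: Pz)
      have "chart_inv c (map_of_chart c q) = q" using chart_inv_map_of_chart[OF ch q(1)] .
      then have "j (fst (map_of_chart c q)) = q"
        using q(2) by (simp add: j_def transverse_proj_def flip: q(2))
      moreover have "fst (map_of_chart c q) \<in> ball_of c"
        using map_of_chart_in[OF ch q(1)] by auto
      ultimately show "q \<in> j ` ball_of c" by (metis image_eqI)
    qed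
  qed (use jP in blast)
  ultimately show ?thesis by simp
qed

lemma leaf_plaque:
  assumes "P \<in> leaf_plaques"
  shows "openin leaf_top P" "connectedin leaf_top P" "P \<noteq> {}"
    "\<And>p q. p \<in> P \<Longrightarrow> q \<in> P \<Longrightarrow> (p, q) \<in> E"
proof -
  obtain c where c: "c \<in> \<U>" "P \<in> plaques c" using assms by (auto simp: leaf_plaques_def)
  then show "openin leaf_top P" "connectedin leaf_top P" "P \<noteq> {}"
    using openin_plaque connectedin_plaque plaque_nonempty[OF is_chart_\<U>] \<U>_subset by blast+
  show "(p, q) \<in> E" if "p \<in> P" "q \<in> P" for p q
    using plaque_eq_Image[OF is_chart_\<U>[OF c(1)] c(2) that(1)] that(2) c(1) by (auto simp: E_def)
qed

lemma E_imp_leaf_plaque: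
  assumes "(p, q) \<in> E"
  shows "\<exists>P\<in>leaf_plaques. p \<in> P \<and> q \<in> P"
proof -
  obtain c where c: "c \<in> \<U>" "(p, q) \<in> plaque_rel c" using assms by (auto simp: E_def)
  then have "plaque_rel c `` {p} \<in> plaques c" "p \<in> plaque_rel c `` {p}" "q \<in> plaque_rel c `` {p}"
    using plaque_in_plaques[OF is_chart_\<U>] by (auto simp: plaque_rel_def)
  then show ?thesis using c(1) unfolding leaf_plaques_def by blast
qed

lemma E_refl: "p \<in> topspace X \<Longrightarrow> (p, p) \<in> E"
  using \<U>_covers by (auto simp: E_def plaque_rel_def)

lemma E_sym: "sym E"
  by (auto simp: sym_def E_def plaque_rel_def)

lemma E_subset: "E \<subseteq> topspace X \<times> topspace X"
  using \<U>_covers by (auto simp: E_def plaque_rel_def)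

text \<open>Chains stay in the leaf because plaques are connected. Conversely, a plaque lies in the
  class of \<open>x\<close> or misses it, so the class and its complement are both open in the leaf
  topology, and a connected set cannot meet both.\<close>

lemma leaf_eq:
  assumes x: "x \<in> topspace X"
  shows "leaf n X \<A> x = E\<^sup>* `` {x}"
proof
  have trans: "(p, q) \<in> E\<^sup>* \<longleftrightarrow> (p, r) \<in> E\<^sup>*" if "(q, r) \<in> E" for p q r
    using that E_sym by (meson rtrancl.rtrancl_into_rtrancl symD)
  show "E\<^sup>* `` {x} \<subseteq> leaf n X \<A> x"
  proof clarify
    fix y assume "(x, y) \<in> E\<^sup>*"
    then show "y \<in> leaf n X \<A> x"
    proof (induction rule: rtrancl_induct)
      case base
      then show ?case
        using x by (simp add: leaf_def topspace_leaf_topology connected_component_of_refl)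
    next
      case (step y z)
      obtain P where P: "P \<in> leaf_plaques" "y \<in> P" "z \<in> P"
        using E_imp_leaf_plaque step.hyps(2) by blast
      then have "connected_component_of leaf_top y z"
        using leaf_plaque(2) unfolding connected_component_of_def by blast
      then show ?case
        using step.IH connected_component_of_trans by (auto simp: leaf_def)
    qed
  qed
  show "leaf n X \<A> x \<subseteq> E\<^sup>* `` {x}"
  proof (rule ccontr)
    assume "\<not> ?thesis"
    then obtain y where y: "y \<in> leaf n X \<A> x" "(x, y) \<notin> E\<^sup>*" by blast
    let ?E1 = "\<Union>{P \<in> leaf_plaques. P \<subseteq> E\<^sup>* `` {x}}"
    let ?E2 = "\<Union>{P \<in> leaf_plaques. P \<inter> E\<^sup>* `` {x} = {}}"
    have 1: "q \<in> ?E1" if q: "q \<in> topspace X" "(x, q) \<in> E\<^sup>*" for q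
    proof -
      obtain P where P: "P \<in> leaf_plaques" "q \<in> P" using E_imp_leaf_plaque[OF E_refl[OF q(1)]] by blast
      then have "P \<subseteq> E\<^sup>* `` {x}" using leaf_plaque(4)[of P q] trans q(2) by blast
      with P show ?thesis by blast
    qed
    have 2: "q \<in> ?E2" if q: "q \<in> topspace X" "(x, q) \<notin> E\<^sup>*" for q
    proof -
      obtain P where P: "P \<in> leaf_plaques" "q \<in> P" using E_imp_leaf_plaque[OF E_refl[OF q(1)]] by blast
      then have "P \<inter> E\<^sup>* `` {x} = {}" using leaf_plaque(4)[of P q] trans q(2) by blast
      with P show ?thesis by blast
    qed
    have "openin leaf_top ?E1" "openin leaf_top ?E2" using leaf_plaque(1) by (blast intro: openin_Union)+
    moreover have conn: "connectedin leaf_top (leaf n X \<A> x)"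
      by (simp add: leaf_def connectedin_connected_component_of)
    moreover have sub: "leaf n X \<A> x \<subseteq> topspace X"
      using connectedin_subset_topspace[OF conn] topspace_leaf_topology by simp
    moreover have "leaf n X \<A> x \<subseteq> ?E1 \<union> ?E2" using 1 2 sub by blast
    moreover have "x \<in> leaf n X \<A> x"
      using x by (simp add: leaf_def topspace_leaf_topology connected_component_of_refl)
    then have "?E1 \<inter> leaf n X \<A> x \<noteq> {}" using 1[OF x] by blast
    moreover have "?E2 \<inter> leaf n X \<A> x \<noteq> {}" using 2[of y] y sub by blast
    moreover have "?E1 \<inter> ?E2 \<inter> leaf n X \<A> x = {}" by blast
    ultimately show False using connectedinD[of leaf_top "leaf n X \<A> x" ?E1 ?E2] by blast
  qed
qed

text \<open>One plaque is taken for each step; the count is an inequality because a plaque may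
  recur. At least one step is needed for the union to contain \<open>x\<close>.\<close>

lemma relpow_imp_plaque_chain:
  assumes "(x, y) \<in> E ^^ Suc k"
  shows "\<exists>\<P>. finite \<P> \<and> card \<P> \<le> Suc k \<and> \<P> \<subseteq> leaf_plaques \<and> connectedin leaf_top (\<Union>\<P>) \<and>
    x \<in> \<Union>\<P> \<and> y \<in> \<Union>\<P>"
  using assms
proof (induction k arbitrary: y)
  case 0
  then obtain P where P: "P \<in> leaf_plaques" "x \<in> P" "y \<in> P"
    using E_imp_leaf_plaque[of x y] by auto
  then show ?case using leaf_plaque(2)[of P] by (intro exI[of _ "{P}"]) auto
next
  case (Suc k)
  then obtain z where z: "(x, z) \<in> E ^^ Suc k" "(z, y) \<in> E" by auto
  obtain \<P> where \<P>: "finite \<P>" "card \<P> \<le> Suc k" "\<P> \<subseteq> leaf_plaques" "connectedin leaf_top (\<Union>\<P>)"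
    "x \<in> \<Union>\<P>" "z \<in> \<Union>\<P>" using Suc.IH[OF z(1)] by blast
  obtain P where P: "P \<in> leaf_plaques" "z \<in> P" "y \<in> P" using E_imp_leaf_plaque[OF z(2)] by blast
  have "connectedin leaf_top (P \<union> \<Union>\<P>)"
    using leaf_plaque(2)[OF P(1)] \<P>(4,6) P(2) by (intro connectedin_Un) blast+
  moreover have "card (insert P \<P>) \<le> Suc (Suc k)"
    using \<P>(1,2) card_insert_le_m1[of "Suc (Suc k)" \<P> P] by simp
  ultimately show ?case
    using \<P> P by (intro exI[of _ "insert P \<P>"]) auto
qed

text \<open>A connected union of plaques cannot skip a graph distance from \<open>x\<close>.\<close>

lemma relpow_if_plaque_chain:
  assumes \<P>: "finite \<P>" "\<P> \<subseteq> leaf_plaques" "connectedin leaf_top (\<Union>\<P>)" "x \<in> \<Union>\<P>" "y \<in> \<Union>\<P>"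
  shows "\<exists>j\<le>card \<P>. (x, y) \<in> E ^^ j"
proof -
  define \<delta> where "\<delta> = (\<lambda>q. LEAST k. (x, q) \<in> E ^^ k)"
  \<comment> \<open>The smallest graph distance \<delta> from \<open>x\<close> on a plaque. Points
    of a plaque are adjacent, so \<delta> takes only the values \<open>m P\<close> and
    \<open>Suc (m P)\<close> there.\<close>
  define m where "m = (\<lambda>P. LEAST k. \<exists>q\<in>P. \<delta> q = k)"
  have x: "x \<in> topspace X"
    using \<P>(3,4) connectedin_subset_topspace topspace_leaf_topology by blast
  have "\<Union>\<P> \<subseteq> leaf n X \<A> x"
    unfolding leaf_def using \<P>(3,4) by (rule connected_component_of_maximal)
  then have reach: "(x, q) \<in> E ^^ \<delta> q" if "q \<in> \<Union>\<P>" for q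
    unfolding \<delta>_def by (intro LEAST_relpow) (use that leaf_eq[OF x] in blast)
  have step: "\<delta> q' \<le> Suc (\<delta> q)" if "P \<in> \<P>" "q \<in> P" "q' \<in> P" for P q q'
  proof -
    have "(q, q') \<in> E" using leaf_plaque(4) \<P>(2) that by blast
    then have "(x, q') \<in> E ^^ Suc (\<delta> q)" using reach[of q] that by auto
    then show ?thesis unfolding \<delta>_def by (rule Least_le)
  qed
  have m_ex: "\<exists>q\<in>P. \<delta> q = m P" if "P \<in> \<P>" for P
  proof -
    have "\<exists>k. \<exists>q\<in>P. \<delta> q = k" using leaf_plaque(3) that \<P>(2) by blast
    then show ?thesis unfolding m_def by (rule LeastI_ex)
  qed
  have m_le: "m P \<le> \<delta> q" if "q \<in> P" for P q
    unfolding m_def by (rule Least_le) (use that in blast)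
  have le_m: "\<delta> q \<le> Suc (m P)" if "P \<in> \<P>" "q \<in> P" for P q
    using m_ex[OF that(1)] step[OF that(1)] that(2) by metis
  have "{..<\<delta> y} \<subseteq> m ` \<P>"
  proof
    fix j assume "j \<in> {..<\<delta> y}"
    then have j: "j < \<delta> y" by simp
    show "j \<in> m ` \<P>"
    proof (rule ccontr)
      \<comment> \<open>If \<open>m\<close> skipped \<open>j\<close>, the plaques with
        \<open>m\<close> below \<open>j\<close> and those with \<open>m\<close> above
        \<open>j\<close> would separate the union: a common point would have \<delta> both at most
        \<open>j\<close> and greater than \<open>j\<close>. So \<open>m\<close> attains all values
        below \<delta>\<open>y\<close>, which forces that many plaques.\<close>
      assume neg: "j \<notin> m ` \<P>"
      let ?E1 = "\<Union>{P \<in> \<P>. m P < j}" and ?E2 = "\<Union>{P \<in> \<P>. m P > j}"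
      have "openin leaf_top ?E1" "openin leaf_top ?E2" using leaf_plaque(1) \<P>(2) by (blast intro: openin_Union)+
      moreover have "\<Union>\<P> \<subseteq> ?E1 \<union> ?E2" using neg by (force simp: neq_iff)
      moreover have "?E1 \<inter> ?E2 \<inter> \<Union>\<P> = {}"
      proof -
        have False if "P \<in> \<P>" "m P < j" "j < m Q" "q \<in> P" "q \<in> Q" for P Q q
          using le_m[OF that(1,4)] m_le[OF that(5)] that(2,3) by linarith
        then show ?thesis by blast
      qed
      moreover obtain P where P: "P \<in> \<P>" "x \<in> P" using \<P>(4) by blast
      have "\<delta> x = 0" unfolding \<delta>_def by (rule Least_equality) auto
      then have "m P = 0" using m_le[OF P(2)] by simp
      then have "m P < j" using neg P(1) by (metis gr0I image_eqI)
      then have "?E1 \<inter> \<Union>\<P> \<noteq> {}" using P by blast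
      moreover obtain Q where Q: "Q \<in> \<P>" "y \<in> Q" using \<P>(5) by blast
      have "j \<le> m Q" using le_m[OF Q] j by simp
      then have "j < m Q" using neg Q(1) by (metis image_eqI le_neq_implies_less)
      then have "?E2 \<inter> \<Union>\<P> \<noteq> {}" using Q by blast
      ultimately show False using connectedinD[OF \<P>(3), of ?E1 ?E2] by blast
    qed
  qed
  then have "\<delta> y \<le> card \<P>"
    using card_mono[OF finite_imageI[OF \<P>(1)]] card_image_le[OF \<P>(1), of m]
    by (metis card_lessThan le_trans)
  then show ?thesis using reach[OF \<P>(5)] by blast
qed

lemma leaf_dist_eq:
  assumes "(x, y) \<in> E\<^sup>*"
  shows "leaf_dist n X \<A> \<U> x y = real (LEAST k. (x, y) \<in> E ^^ k)"
proof (cases "x = y")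
  case True
  then have "(LEAST k. (x, y) \<in> E ^^ k) = 0" by (intro Least_equality) auto
  then show ?thesis using True by (simp add: leaf_dist_def)
next
  case False
  define Q where "Q = (\<lambda>k. \<exists>\<P>. finite \<P> \<and> card \<P> = k \<and> \<P> \<subseteq> leaf_plaques \<and>
    connectedin leaf_top (\<Union>\<P>) \<and> x \<in> \<Union>\<P> \<and> y \<in> \<Union>\<P>)"
  let ?k = "LEAST k. (x, y) \<in> E ^^ k"
  have k: "(x, y) \<in> E ^^ ?k" using LEAST_relpow[OF assms] .
  have lower: "?k \<le> j" if "Q j" for j
  proof -
    obtain \<P> where \<P>: "finite \<P>" "card \<P> = j" "\<P> \<subseteq> leaf_plaques" "connectedin leaf_top (\<Union>\<P>)"
      "x \<in> \<Union>\<P>" "y \<in> \<Union>\<P>"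
      using \<open>Q j\<close> unfolding Q_def by (elim exE conjE) (rule that; assumption)
    then obtain i where "i \<le> j" "(x, y) \<in> E ^^ i"
      using relpow_if_plaque_chain[OF \<P>(1,3-6)] by blast
    then show ?thesis using Least_le[of "\<lambda>k. (x, y) \<in> E ^^ k" i] by simp
  qed
  have "?k \<noteq> 0"
  proof
    assume "?k = 0"
    then show False using k False by simp
  qed
  then obtain k' where "?k = Suc k'" using not0_implies_Suc by blast
  then have "(x, y) \<in> E ^^ Suc k'" using k by simp
  from relpow_imp_plaque_chain[OF this]
  obtain \<P> where \<P>: "finite \<P> \<and> card \<P> \<le> Suc k' \<and> \<P> \<subseteq> leaf_plaques \<and>
      connectedin leaf_top (\<Union>\<P>) \<and> x \<in> \<Union>\<P> \<and> y \<in> \<Union>\<P>" by (elim exE) (rule that)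
  \<comment> \<open>The chain has at most \<open>?k\<close> plaques, possibly fewer a priori;
    \<open>lower\<close> then forces equality, so the minimum is attained at
    \<open>?k\<close>.\<close>
  have j: "Q (card \<P>)" "card \<P> \<le> ?k"
    unfolding Q_def \<open>?k = Suc k'\<close> by (rule exI[of _ \<P>]) (use \<P> in simp_all)
  have "(LEAST k. Q k) = ?k"
  proof (rule Least_equality)
    show "Q ?k" using j lower[OF j(1)] by simp
  qed (rule lower)
  then show ?thesis using False by (simp add: leaf_dist_def Q_def leaf_plaques_def)
qed

lemma leaf_dist_le_iff:
  assumes "(x, y) \<in> E\<^sup>*"
  shows "leaf_dist n X \<A> \<U> x y \<le> real k \<longleftrightarrow> (\<exists>j\<le>k. (x, y) \<in> E ^^ j)"
proof
  show "\<exists>j\<le>k. (x, y) \<in> E ^^ j" if "leaf_dist n X \<A> \<U> x y \<le> real k"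
    using that LEAST_relpow[OF assms] leaf_dist_eq[OF assms] by auto
  show "leaf_dist n X \<A> \<U> x y \<le> real k" if "\<exists>j\<le>k. (x, y) \<in> E ^^ j"
    using that Least_le[of "\<lambda>k. (x, y) \<in> E ^^ k"] leaf_dist_eq[OF assms] by fastforce
qed

lemma Metric_space_leaf:
  assumes x: "x \<in> topspace X"
  shows "Metric_space (leaf n X \<A> x) (leaf_dist n X \<A> \<U>)"
proof
  have inE: "(p, q) \<in> E\<^sup>*" if "p \<in> leaf n X \<A> x" "q \<in> leaf n X \<A> x" for p q
    using that E_sym unfolding leaf_eq[OF x] by (metis Image_singleton_iff rtrancl_trans symD sym_rtrancl)
  let ?d = "leaf_dist n X \<A> \<U>"
  show "0 \<le> ?d p q" for p q by (simp add: leaf_dist_def)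
  show "?d p q = ?d q p" for p q
  proof -
    have "(p \<in> S \<and> q \<in> S) = (q \<in> S \<and> p \<in> S)" for S by blast
    then show ?thesis by (simp only: leaf_dist_def eq_commute[of p q])
  qed
  show "?d p q = 0 \<longleftrightarrow> p = q" if "p \<in> leaf n X \<A> x" "q \<in> leaf n X \<A> x" for p q
    using leaf_dist_le_iff[OF inE[OF that], of 0] by (auto simp: leaf_dist_def)
  show "?d p r \<le> ?d p q + ?d q r"
    if "p \<in> leaf n X \<A> x" "q \<in> leaf n X \<A> x" "r \<in> leaf n X \<A> x" for p q r
  proof -
    let ?k = "LEAST k. (p, q) \<in> E ^^ k" and ?l = "LEAST k. (q, r) \<in> E ^^ k"
    have pq: "(p, q) \<in> E\<^sup>*" and qr: "(q, r) \<in> E\<^sup>*" and pr: "(p, r) \<in> E\<^sup>*" using inE that by auto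
    have "(p, r) \<in> E ^^ (?k + ?l)"
      using LEAST_relpow[OF pq] LEAST_relpow[OF qr] by (auto simp: relpow_add)
    then have "?d p r \<le> real (?k + ?l)" using leaf_dist_le_iff[OF pr] by blast
    then show ?thesis using leaf_dist_eq[OF pq] leaf_dist_eq[OF qr] by simp
  qed
qed

end


section \<open>Coding leaves by holonomy words\<close>

context regular_atlas
begin

text \<open>A finite subcover by the neighborhoods of local finiteness meets only finitely many
  charts. Charts with empty domain meet nothing and escape this count.\<close>

lemma finite_nonempty_charts: "finite {c \<in> \<U>. dom_of c \<noteq> {}}"
proof -
  have "\<forall>x\<in>topspace X. \<exists>V. openin X V \<and> x \<in> V \<and> finite {c \<in> \<U>. dom_of c \<inter> V \<noteq> {}}"
    using regular by (simp add: regular_foliated_atlas_def)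
  from bchoice[OF this]
  obtain V where "\<forall>x\<in>topspace X. openin X (V x) \<and> x \<in> V x \<and>
      finite {c \<in> \<U>. dom_of c \<inter> V x \<noteq> {}}" by (rule exE)
  then have V: "\<And>x. x \<in> topspace X \<Longrightarrow> openin X (V x)"
    "\<And>x. x \<in> topspace X \<Longrightarrow> x \<in> V x"
    "\<And>x. x \<in> topspace X \<Longrightarrow> finite {c \<in> \<U>. dom_of c \<inter> V x \<noteq> {}}" by simp_all
  have "compact_space X" using compact_Polish by (simp add: compact_Polish_foliated_space_def)
  moreover have "\<forall>W\<in>V ` topspace X. openin X W" using V(1) by blast
  moreover have "topspace X \<subseteq> \<Union>(V ` topspace X)" using V(2) by (intro subsetI UN_I)
  ultimately have "\<exists>\<F>. finite \<F> \<and> \<F> \<subseteq> V ` topspace X \<and> topspace X \<subseteq> \<Union>\<F>"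
    by (simp only: compact_space_alt)
  then obtain \<F> where \<F>: "finite \<F>" "\<F> \<subseteq> V ` topspace X" "topspace X \<subseteq> \<Union>\<F>"
    by (elim exE conjE) (rule that)
  have "finite (\<Union>W\<in>\<F>. {c \<in> \<U>. dom_of c \<inter> W \<noteq> {}})"
    using \<F>(1,2) V(3) by (intro finite_UN_I) auto
  moreover have "{c \<in> \<U>. dom_of c \<noteq> {}} \<subseteq> (\<Union>W\<in>\<F>. {c \<in> \<U>. dom_of c \<inter> W \<noteq> {}})"
  proof
    fix c assume c: "c \<in> {c \<in> \<U>. dom_of c \<noteq> {}}"
    then obtain q where q: "q \<in> dom_of c" by blast
    then have "q \<in> topspace X" using dom_of_subset[OF is_chart_\<U>] c by blast
    then obtain W where "W \<in> \<F>" "q \<in> W" using \<F>(3) by blast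
    then show "c \<in> (\<Union>W\<in>\<F>. {c \<in> \<U>. dom_of c \<inter> W \<noteq> {}})" using c q by blast
  qed
  ultimately show ?thesis by (rule finite_subset[rotated])
qed

text \<open>Regularity identifies only the closures of the plaques \<open>Q\<close> and
  \<open>Q'\<close>. But a plaque is relatively closed in its chart domain, since points are closed
  in the Hausdorff transversal; so \<open>r'\<close>, lying in the closure of \<open>Q\<close> and
  in the domain of \<open>c\<close>, lies in \<open>Q\<close>.\<close>

lemma plaque_rel_transfer:
  assumes c: "c \<in> \<U>" and d: "d \<in> \<U>" and qr: "(q, r) \<in> plaque_rel d" "(q, r') \<in> plaque_rel d"
    and r: "r \<in> dom_of c" "r' \<in> dom_of c"
  shows "(r, r') \<in> plaque_rel c"
proof -
  note chc = is_chart_\<U>[OF c]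
  let ?P = "plaque_rel d `` {q}"
  define Q where "Q = plaque_rel c `` {r}"
  define Q' where "Q' = plaque_rel c `` {r'}"
  have P: "?P \<in> plaques d"
    using qr(1) plaque_in_plaques[OF is_chart_\<U>[OF d]] by (simp add: plaque_rel_def)
  have Q: "Q \<in> plaques c" "Q' \<in> plaques c"
    unfolding Q_def Q'_def using r by (simp_all add: plaque_in_plaques[OF chc])
  have mem: "r \<in> ?P" "r' \<in> ?P" "r \<in> Q" "r' \<in> Q'"
    using qr r by (auto simp: plaque_rel_def Q_def Q'_def)
  have cl: "S \<subseteq> X closure_of S" if "S \<in> {?P, Q, Q'}" for S
    using that P Q c d \<U>_subset plaque_subset by (intro closure_of_subset) blast
  have "X closure_of ?P \<inter> X closure_of Q \<noteq> {}" "X closure_of ?P \<inter> X closure_of Q' \<noteq> {}"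
    using mem cl by blast+
  then have "X closure_of Q = X closure_of Q'"
    using regular c d P Q unfolding regular_foliated_atlas_def by blast
  then have r': "r' \<in> X closure_of Q" using mem cl by blast
  let ?O = "{p \<in> dom_of c. transverse_proj c p \<in> topspace (trans_of c) - {transverse_proj c r}}"
  have "openin (trans_of c) (topspace (trans_of c) - {transverse_proj c r})"
    using Hausdorff_trans_of[OF chc] transverse_proj_in[OF chc r(1)]
    by (simp add: openin_diff closedin_Hausdorff_sing_eq)
  then have "openin X ?O" by (rule openin_transverse_preimage[OF chc])
  moreover have "?O \<inter> Q = {}" by (auto simp: plaque_rel_def Q_def)
  ultimately have "?O \<inter> X closure_of Q = {}" by (simp only: openin_Int_closure_of_eq_empty)
  then have "r' \<notin> ?O" using r' by blast
  then show ?thesis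
    using r transverse_proj_in[OF chc r(2)] by (simp add: plaque_rel_def)
qed

text \<open>A fixed but arbitrary point of the ball, not necessarily its geometric center.\<close>

definition center :: "('a, 'z) chart \<Rightarrow> nat \<Rightarrow> real" where
  "center c = (SOME b. b \<in> ball_of c)"

lemma center:
  assumes "c \<in> \<U>"
  shows "center c \<in> ball_of c"
proof -
  have "is_open_ball n (ball_of c)" using is_chart_\<U>[OF assms] by (simp add: is_chart_def)
  then show ?thesis unfolding center_def by (rule someI_ex[OF is_open_ball_nonempty])
qed

text \<open>The holonomy map \<open>h\<^sub>d\<^sub>c\<close>, with each plaque represented by its central point.\<close>

definition hol_dom :: "('a, 'z) chart \<Rightarrow> ('a, 'z) chart \<Rightarrow> 'a set" where
  "hol_dom d c = {q. \<exists>r\<in>dom_of c. (q, r) \<in> plaque_rel d}"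

definition hol :: "('a, 'z) chart \<Rightarrow> ('a, 'z) chart \<Rightarrow> 'a \<Rightarrow> 'a" where
  "hol d c q = slide c (center c) (SOME r. r \<in> dom_of c \<and> (q, r) \<in> plaque_rel d)"

text \<open>The value does not depend on the chosen \<open>r\<close>: two choices lie in one plaque
  of \<open>c\<close>, and \<open>slide\<close> sees only the plaque.\<close>

lemma hol_eq:
  assumes "c \<in> \<U>" "d \<in> \<U>" "r \<in> dom_of c" "(q, r) \<in> plaque_rel d"
  shows "hol d c q = slide c (center c) r"
proof -
  let ?r = "SOME r. r \<in> dom_of c \<and> (q, r) \<in> plaque_rel d"
  have "?r \<in> dom_of c \<and> (q, ?r) \<in> plaque_rel d" by (rule someI[of _ r]) (use assms in blast)
  then have "(?r, r) \<in> plaque_rel c" using plaque_rel_transfer assms by blast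
  then show ?thesis by (simp add: hol_def slide_def plaque_rel_def)
qed

lemma hol_plaque_rel:
  assumes "c \<in> \<U>" "d \<in> \<U>" "r \<in> dom_of c" "(q, r) \<in> plaque_rel d"
  shows "(r, hol d c q) \<in> plaque_rel c"
  using slide[OF is_chart_\<U>[OF assms(1)] center[OF assms(1)] assms(3)] assms(3)
  by (simp add: hol_eq[OF assms] plaque_rel_def)

text \<open>This covers openness of the domain and continuity at once. The chosen \<open>r\<close>
  in \<open>hol\<close> need not depend continuously on \<open>q\<close>; instead \<open>r\<close>
  is reached as \<open>slide d b q\<close> with its ball coordinate \<open>b\<close> held fixed,
  which is an open condition on \<open>q\<close>, and the union is taken over all
  \<open>b\<close>.\<close>

lemma openin_hol_preimage:
  assumes c: "c \<in> \<U>" and d: "d \<in> \<U>" and V: "openin X V"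
  shows "openin X {q \<in> hol_dom d c. hol d c q \<in> V}"
proof -
  note chc = is_chart_\<U>[OF c] and chd = is_chart_\<U>[OF d]
  let ?V = "{r \<in> dom_of c. slide c (center c) r \<in> V}"
  have V': "openin X ?V" by (rule openin_slide_preimage[OF chc center[OF c] V])
  have "{q \<in> hol_dom d c. hol d c q \<in> V} = (\<Union>b\<in>ball_of d. {q \<in> dom_of d. slide d b q \<in> ?V})"
  proof (intro equalityI subsetI)
    fix q assume "q \<in> {q \<in> hol_dom d c. hol d c q \<in> V}"
    then obtain r where r: "r \<in> dom_of c" "(q, r) \<in> plaque_rel d" "hol d c q \<in> V"
      by (auto simp: hol_dom_def)
    then have "r \<in> ?V" using hol_eq[OF c d r(1,2)] by simp
    then show "q \<in> (\<Union>b\<in>ball_of d. {q \<in> dom_of d. slide d b q \<in> ?V})"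
      using slide_self[OF chd r(2)] r(2)
      by (intro UN_I[of "fst (map_of_chart d r)"]) (auto simp: plaque_rel_def)
  next
    fix q assume "q \<in> (\<Union>b\<in>ball_of d. {q \<in> dom_of d. slide d b q \<in> ?V})"
    then obtain b where b: "b \<in> ball_of d" "q \<in> dom_of d" "slide d b q \<in> ?V" by blast
    then have r: "slide d b q \<in> dom_of c" "(q, slide d b q) \<in> plaque_rel d"
      using slide[OF chd b(1,2)] by (auto simp: plaque_rel_def)
    then show "q \<in> {q \<in> hol_dom d c. hol d c q \<in> V}"
      using hol_eq[OF c d r] b(3) by (auto simp: hol_dom_def)
  qed
  moreover have "openin X {q \<in> dom_of d. slide d b q \<in> ?V}" if "b \<in> ball_of d" for b
    by (rule openin_slide_preimage[OF chd that V'])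
  ultimately show ?thesis by auto
qed

end

section \<open>Words in the holonomy maps of finitely many charts\<close>

locale enumerated_atlas = regular_atlas n X \<A> \<U>
  for n :: nat and X :: "'a topology" and \<A> \<U> :: "('a, 'z) chart set" +
  fixes cs :: "nat \<Rightarrow> ('a, 'z) chart" and m :: nat
  assumes cs: "cs ` {..<m} = {c \<in> \<U>. dom_of c \<noteq> {}}"
begin

lemma cs_in: "i < m \<Longrightarrow> cs i \<in> \<U>"
  using cs by auto

lemma E_eq: "E = (\<Union>i<m. plaque_rel (cs i))"
proof -
  have "plaque_rel c = {}" if "dom_of c = {}" for c :: "('a, 'z) chart"
    using that by (simp add: plaque_rel_def)
  then have "E = (\<Union>c\<in>{c \<in> \<U>. dom_of c \<noteq> {}}. plaque_rel c)" by (auto simp: E_def)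
  then show ?thesis by (simp flip: cs)
qed

text \<open>A letter \<open>(i, j)\<close> leads from a plaque of \<open>cs i\<close> to a plaque of
  \<open>cs j\<close> meeting it. Letters are pairs of indices, so words form a countable type
  independent of the charts; an index that is not below \<open>m\<close> makes the domain
  empty.\<close>

fun word_dom :: "(nat \<times> nat) list \<Rightarrow> 'a set" where
  "word_dom [] = topspace X"
| "word_dom ((i, j) # w) =
     {q \<in> hol_dom (cs i) (cs j). i < m \<and> j < m \<and> hol (cs i) (cs j) q \<in> word_dom w}"

fun word_map :: "(nat \<times> nat) list \<Rightarrow> 'a \<Rightarrow> 'a" where
  "word_map [] q = q"
| "word_map ((i, j) # w) q = word_map w (hol (cs i) (cs j) q)"

lemma openin_word_preimage:
  assumes "openin X V"
  shows "openin X {q \<in> word_dom w. word_map w q \<in> V}"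
proof (induction w)
  case Nil
  have "{q \<in> topspace X. q \<in> V} = V" using openin_subset[OF assms] by blast
  then show ?case using assms by simp
next
  case (Cons ij w)
  obtain i j where ij: "ij = (i, j)" by (cases ij)
  show ?case
  proof (cases "i < m \<and> j < m")
    case True
    then have "{q \<in> word_dom (ij # w). word_map (ij # w) q \<in> V} =
        {q \<in> hol_dom (cs i) (cs j). hol (cs i) (cs j) q \<in> {q \<in> word_dom w. word_map w q \<in> V}}"
      by (auto simp: ij)
    then show ?thesis using openin_hol_preimage[OF _ _ Cons.IH] cs_in True by simp
  next
    case False
    then have "{q \<in> word_dom (ij # w). word_map (ij # w) q \<in> V} = {}" by (auto simp: ij)
    then show ?thesis by (simp only: openin_empty)
  qed
qed

text \<open>One plaque of \<open>cs i\<close> leads to the intersection and one of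
  \<open>cs j\<close> to the new center; this is the source of the factor 2 for word
  lengths.\<close>

lemma hol_dom_E:
  assumes "i < m" "j < m" "q \<in> hol_dom (cs i) (cs j)"
  shows "(q, hol (cs i) (cs j) q) \<in> E ^^ 2"
proof -
  obtain r where r: "r \<in> dom_of (cs j)" "(q, r) \<in> plaque_rel (cs i)"
    using assms(3) by (auto simp: hol_dom_def)
  then have "(r, hol (cs i) (cs j) q) \<in> plaque_rel (cs j)"
    using hol_plaque_rel cs_in assms by blast
  then have "(q, r) \<in> E" "(r, hol (cs i) (cs j) q) \<in> E"
    using r(2) assms(1,2) by (auto simp: E_eq)
  then show ?thesis by (auto simp: numeral_2_eq_2)
qed

lemma word_map_E:
  assumes "q \<in> word_dom w"
  shows "(q, word_map w q) \<in> E ^^ (2 * length w)"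
  using assms
proof (induction w arbitrary: q)
  case (Cons ij w)
  obtain i j where ij: "ij = (i, j)" by (cases ij)
  let ?q = "hol (cs i) (cs j) q"
  have "(q, ?q) \<in> E ^^ 2" using Cons.prems hol_dom_E by (simp add: ij)
  moreover have "(?q, word_map w ?q) \<in> E ^^ (2 * length w)" using Cons by (simp add: ij)
  ultimately have "(q, word_map w ?q) \<in> E ^^ (2 + 2 * length w)"
    unfolding relpow_add by (rule relcompI)
  then show ?case by (simp add: ij)
qed simp

lemma word_append:
  "q \<in> word_dom (u @ v) \<longleftrightarrow> q \<in> word_dom u \<and> word_map u q \<in> word_dom v"
  "word_map (u @ v) q = word_map v (word_map u q)"
proof -
  have dom: "word_dom w \<subseteq> topspace X" for w
  proof (cases w)
    case (Cons ij w')
    obtain i j where ij: "ij = (i, j)" by (cases ij)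
    show ?thesis
    proof
      fix q assume q: "q \<in> word_dom w"
      then have "i < m" "q \<in> dom_of (cs i)" by (auto simp: Cons ij hol_dom_def plaque_rel_def)
      then show "q \<in> topspace X" using dom_of_subset[OF is_chart_\<U>[OF cs_in]] by blast
    qed
  qed simp
  show "word_map (u @ v) q = word_map v (word_map u q)"
    by (induction u arbitrary: q) auto
  show "q \<in> word_dom (u @ v) \<longleftrightarrow> q \<in> word_dom u \<and> word_map u q \<in> word_dom v"
    by (induction u arbitrary: q) (use dom[of v] in auto)
qed

text \<open>A chain of plaques is followed by the word that passes from each plaque to the next one.\<close>

lemma word_reaches:
  assumes "(p, q) \<in> E ^^ k" "p \<in> topspace X"
  shows "\<exists>u. length u = k \<and> p \<in> word_dom u \<and> (word_map u p, q) \<in> E"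
  using assms(1)
proof (induction k arbitrary: q)
  case 0
  then show ?case using E_refl assms(2) by (intro exI[of _ "[]"]) auto
next
  case (Suc k)
  then obtain r where r: "(p, r) \<in> E ^^ k" "(r, q) \<in> E" by auto
  obtain u where u: "length u = k" "p \<in> word_dom u" "(word_map u p, r) \<in> E"
    using Suc.IH[OF r(1)] by blast
  \<comment> \<open>The word only reaches a plaque shared with the target. The new letter consists
    of the chart \<open>i\<close> of the plaque shared with \<open>r\<close> and the chart
    \<open>j\<close> of the plaque containing \<open>r\<close> and \<open>q\<close>.\<close>
  obtain i where i: "i < m" "(word_map u p, r) \<in> plaque_rel (cs i)" using u(3) by (auto simp: E_eq)
  obtain j where j: "j < m" "(r, q) \<in> plaque_rel (cs j)" using r(2) by (auto simp: E_eq)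
  have rj: "r \<in> dom_of (cs j)" using j(2) by (simp add: plaque_rel_def)
  let ?q = "hol (cs i) (cs j) (word_map u p)"
  have "(r, ?q) \<in> plaque_rel (cs j)" using hol_plaque_rel[OF cs_in cs_in rj i(2)] i(1) j(1) by simp
  then have q: "(?q, q) \<in> E" using j by (auto simp: E_eq plaque_rel_def)
  then have "?q \<in> topspace X" using E_subset by blast
  then have "p \<in> word_dom (u @ [(i, j)])"
    using u(2) i j(1) rj by (auto simp: word_append hol_dom_def)
  with q u(1) show ?case
    by (intro exI[of _ "u @ [(i, j)]"]) (simp add: word_append)
qed

text \<open>A path from the point of \<open>w\<close> towards that of \<open>w'\<close> is sought
  among the continuations \<open>u\<close> of \<open>w\<close>, a countable choice. The final plaque
  is needed because words end at chosen centers.\<close>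

definition word_near :: "'a \<Rightarrow> (nat \<times> nat) list \<Rightarrow> (nat \<times> nat) list \<Rightarrow> nat \<Rightarrow> bool" where
  "word_near q w w' k \<longleftrightarrow> (\<exists>u. length u \<le> k \<and> q \<in> word_dom (w @ u) \<and> q \<in> word_dom w' \<and>
     (word_map (w @ u) q, word_map w' q) \<in> E)"

lemma pred_word_dom: "Measurable.pred (borel_of X) (\<lambda>q. q \<in> word_dom w)"
proof -
  have "openin X {q \<in> word_dom w. word_map w q \<in> topspace X}"
    by (rule openin_word_preimage) simp
  moreover have "{q \<in> word_dom w. word_map w q \<in> topspace X} = {q \<in> topspace X. q \<in> word_dom w}"
    using word_append(1)[of _ w "[]"] word_append(1)[of _ "[]" w] by auto
  ultimately show ?thesis
    by (simp add: pred_def openin_imp_sets_borel_of)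
qed

text \<open>On the open set \<open>both i\<close>, the end points lie in different plaques of
  \<open>cs i\<close> iff disjoint open sets of the transversal separate their coordinates, which is
  an open condition on \<open>q\<close>. Sharing a plaque of \<open>cs i\<close> is thus a
  difference of two open sets.\<close>

lemma pred_word_map_E:
  "Measurable.pred (borel_of X)
     (\<lambda>q. q \<in> word_dom w \<and> q \<in> word_dom w' \<and> (word_map w q, word_map w' q) \<in> E)"
proof -
  define O1 where "O1 = (\<lambda>w S. {q \<in> word_dom w. word_map w q \<in> S})"
  define O2 where "O2 = (\<lambda>(c :: ('a, 'z) chart) S. {q \<in> dom_of c. transverse_proj c q \<in> S})"
  define T where "T = (\<lambda>i. trans_of (cs i))"
  define both where "both = (\<lambda>i. O1 w (dom_of (cs i)) \<inter> O1 w' (dom_of (cs i)))"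
  define differ where "differ = (\<lambda>i. \<Union>(A, B)\<in>{(A, B). openin (T i) A \<and> openin (T i) B \<and> A \<inter> B = {}}.
     O1 w (O2 (cs i) A) \<inter> O1 w' (O2 (cs i) B))"
  have O1: "openin X (O1 w S)" if "openin X S" for w S
    unfolding O1_def by (rule openin_word_preimage[OF that])
  have O2: "openin X (O2 (cs i) A)" if "i < m" "openin (T i) A" for i A
    using that unfolding O2_def T_def by (intro openin_transverse_preimage[OF is_chart_\<U>[OF cs_in]])
  have both: "openin X (both i)" if "i < m" for i
    unfolding both_def using that by (intro openin_Int O1 openin_dom_of[OF is_chart_\<U>[OF cs_in]])
  have differ: "openin X (differ i)" if "i < m" for i
    unfolding differ_def
  proof (rule openin_Union)
    fix W
    assume "W \<in> (\<lambda>(A, B). O1 w (O2 (cs i) A) \<inter> O1 w' (O2 (cs i) B)) `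
      {(A, B). openin (T i) A \<and> openin (T i) B \<and> A \<inter> B = {}}"
    then obtain A B where "openin (T i) A" "openin (T i) B"
      "W = O1 w (O2 (cs i) A) \<inter> O1 w' (O2 (cs i) B)" by auto
    then show "openin X W" using O1 O2[OF that] openin_Int by metis
  qed
  have eq: "{q \<in> word_dom w \<inter> word_dom w'. (word_map w q, word_map w' q) \<in> plaque_rel (cs i)} =
      both i - differ i" if i: "i < m" for i
  proof -
    note ch = is_chart_\<U>[OF cs_in[OF i]]
    let ?t = "transverse_proj (cs i)"
    have "q \<in> differ i \<longleftrightarrow> ?t (word_map w q) \<noteq> ?t (word_map w' q)" if q: "q \<in> both i" for q
    proof
      assume "q \<in> differ i"
      then show "?t (word_map w q) \<noteq> ?t (word_map w' q)"
        by (auto simp: differ_def O1_def O2_def)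
    next
      have dom: "q \<in> word_dom w" "q \<in> word_dom w'" "word_map w q \<in> dom_of (cs i)"
        "word_map w' q \<in> dom_of (cs i)" using q by (auto simp: both_def O1_def)
      assume "?t (word_map w q) \<noteq> ?t (word_map w' q)"
      then have "\<exists>A B. openin (T i) A \<and> openin (T i) B \<and> ?t (word_map w q) \<in> A \<and>
          ?t (word_map w' q) \<in> B \<and> disjnt A B"
        using Hausdorff_trans_of[OF ch] transverse_proj_in[OF ch dom(3)]
          transverse_proj_in[OF ch dom(4)]
        by (simp add: Hausdorff_space_def T_def)
      then obtain A B where "openin (T i) A" "openin (T i) B" "?t (word_map w q) \<in> A"
        "?t (word_map w' q) \<in> B" "disjnt A B" by (elim exE conjE) (rule that)
      then show "q \<in> differ i"
        using dom unfolding differ_def O1_def O2_def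
        by (intro UN_I[of "(A, B)"]) (auto simp: disjnt_def)
    qed
    then show ?thesis by (auto simp: both_def O1_def plaque_rel_def)
  qed
  have "{q \<in> topspace X. q \<in> word_dom w \<and> q \<in> word_dom w' \<and> (word_map w q, word_map w' q) \<in> E} =
      (\<Union>i<m. {q \<in> word_dom w \<inter> word_dom w'. (word_map w q, word_map w' q) \<in> plaque_rel (cs i)})"
    using word_append(1)[of _ "[]" w] by (auto simp: E_eq)
  also have "\<dots> \<in> sets (borel_of X)"
  proof (rule sets.finite_UN)
    show "{q \<in> word_dom w \<inter> word_dom w'. (word_map w q, word_map w' q) \<in> plaque_rel (cs i)}
        \<in> sets (borel_of X)" if "i \<in> {..<m}" for i
    proof -
      have i: "i < m" using that by simp
      show ?thesis
        unfolding eq[OF i] using both[OF i] differ[OF i]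
        by (intro sets.Diff openin_imp_sets_borel_of)
    qed
  qed simp
  finally show ?thesis by (simp add: pred_def)
qed

lemma pred_word_near: "Measurable.pred (borel_of X) (\<lambda>q. word_near q w w' k)"
proof -
  note [measurable] = pred_word_map_E
  have "Measurable.pred (borel_of X) (\<lambda>q. \<exists>u. length u \<le> k \<and>
      (q \<in> word_dom (w @ u) \<and> q \<in> word_dom w' \<and> (word_map (w @ u) q, word_map w' q) \<in> E))"
    by measurable
  then show ?thesis by (simp add: word_near_def)
qed

text \<open>Weighting letters by their indices makes the balls of words finite.\<close>

definition word_length :: "(nat \<times> nat) list \<Rightarrow> nat" where
  "word_length w = sum_list (map (\<lambda>(i, j). i + j + 1) w)"

lemma length_le_word_length: "length w \<le> word_length w"
  unfolding word_length_def by (induction w) auto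

lemma finite_word_length: "finite {w. word_length w \<le> k}"
proof (rule finite_subset)
  show "finite {w. set w \<subseteq> {..k} \<times> {..k} \<and> length w \<le> k}"
    by (intro finite_lists_length_le) auto
  have "i \<le> word_length w" "j \<le> word_length w" if "(i, j) \<in> set w" for i j w
  proof -
    have "i + j + 1 \<le> word_length w"
    proof -
      have "i + j + 1 \<in> set (map (\<lambda>(i, j). i + j + 1) w)" using that by force
      then show ?thesis unfolding word_length_def by (rule member_le_sum_list) simp
    qed
    then show "i \<le> word_length w" "j \<le> word_length w" by auto
  qed
  then show "{w. word_length w \<le> k} \<subseteq> {w. set w \<subseteq> {..k} \<times> {..k} \<and> length w \<le> k}"
    using length_le_word_length by (force intro: order_trans)
qed

text \<open>In a word defined at some point all indices are below \<open>m\<close>, so a letter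
  weighs less than \<open>2 * m\<close>. On such words the weighted length is comparable to the
  number of letters.\<close>

lemma word_length_le: "q \<in> word_dom w \<Longrightarrow> word_length w \<le> 2 * m * length w"
proof (induction w arbitrary: q)
  case (Cons ij w)
  obtain i j where ij: "ij = (i, j)" by (cases ij)
  have "word_length w \<le> 2 * m * length w" "i < m" "j < m"
    using Cons by (auto simp: ij)
  then show ?case by (simp add: ij word_length_def)
qed (simp add: word_length_def)

text \<open>The constant \<open>2 * m + 2\<close> covers all requirements: two plaques per letter,
  weight at most \<open>2 * m\<close> per letter, and one more plaque from the end of a word to its
  target.\<close>

lemma coarse_coding_leaf:
  assumes x: "x \<in> topspace X"
  shows "coarse_coding (leaf n X \<A> x) (leaf_dist n X \<A> \<U>) (2 * m + 2) word_length x
    {w. x \<in> word_dom w} (\<lambda>w. word_map w x) (word_near x)"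
proof -
  let ?L = "leaf n X \<A> x" and ?d = "leaf_dist n X \<A> \<U>"
  interpret Metric_space ?L ?d by (rule Metric_space_leaf[OF x])
  have inE: "(p, q) \<in> E\<^sup>*" if "p \<in> ?L" "q \<in> ?L" for p q
    using that E_sym unfolding leaf_eq[OF x]
    by (metis Image_singleton_iff rtrancl_trans symD sym_rtrancl)
  have xL: "x \<in> ?L" by (simp add: leaf_eq[OF x])
  have top: "?L \<subseteq> topspace X"
  proof
    fix q assume "q \<in> ?L"
    then have "(x, q) \<in> E\<^sup>*" by (simp add: leaf_eq[OF x])
    then show "q \<in> topspace X" using x E_subset by (cases rule: rtrancl.cases) auto
  qed
  have wL: "word_map w x \<in> ?L" if "x \<in> word_dom w" for w
    using word_map_E[OF that] relpow_imp_rtrancl by (auto simp: leaf_eq[OF x])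
  have le: "?d p q \<le> real k" if "p \<in> ?L" "q \<in> ?L" "(p, q) \<in> E ^^ k" for p q k
    using leaf_dist_le_iff[OF inE[OF that(1,2)], of k] that(3) by blast
  show ?thesis
  proof unfold_locales
    show "1 \<le> real (2 * m + 2)" by simp
    show "x \<in> ?L" by (rule xL)
    show "word_map w x \<in> ?L" if "w \<in> {w. x \<in> word_dom w}" for w using wL that by simp
    show "?d x (word_map w x) \<le> real (2 * m + 2) * real (word_length w)"
      if "w \<in> {w. x \<in> word_dom w}" for w
    proof -
      have "?d x (word_map w x) \<le> real (2 * length w)"
        using that by (intro le xL wL word_map_E) auto
      also have "2 * length w \<le> (2 * m + 2) * word_length w"
        using length_le_word_length[of w] by (intro mult_mono) auto
      then have "real (2 * length w) \<le> real ((2 * m + 2) * word_length w)" by (rule of_nat_mono)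
      finally show ?thesis by (simp add: algebra_simps)
    qed
    show "\<exists>w\<in>{w. x \<in> word_dom w}. ?d (word_map w x) q \<le> real (2 * m + 2) \<and>
        real (word_length w) \<le> real (2 * m + 2) * ?d x q" if q: "q \<in> ?L" for q
    proof -
      let ?k = "LEAST k. (x, q) \<in> E ^^ k"
      have d: "?d x q = real ?k" by (rule leaf_dist_eq[OF inE[OF xL q]])
      obtain u where u: "length u = ?k" "x \<in> word_dom u" "(word_map u x, q) \<in> E"
        using word_reaches[OF LEAST_relpow[OF inE[OF xL q]] x] by blast
      have "?d (word_map u x) q \<le> real 1" using u(3) by (intro le wL u(2) q) simp
      moreover have "word_length u \<le> (2 * m + 2) * ?k"
        using word_length_le[OF u(2)] u(1) by simp
      then have "real (word_length u) \<le> real ((2 * m + 2) * ?k)" by (rule of_nat_mono)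
      ultimately show ?thesis using u(2) d by (intro bexI[of _ u]) (auto simp: algebra_simps)
    qed
    show "?d (word_map w x) (word_map w' x) \<le> real (2 * m + 2) * real k + real (2 * m + 2)"
      if "w \<in> {w. x \<in> word_dom w}" "w' \<in> {w. x \<in> word_dom w}" and near: "word_near x w w' k" for w w' k
    proof -
      obtain u where u: "length u \<le> k" "x \<in> word_dom (w @ u)" "(word_map (w @ u) x, word_map w' x) \<in> E"
        using near unfolding word_near_def by blast
      then have "(word_map w x, word_map (w @ u) x) \<in> E ^^ (2 * length u)"
        using word_map_E by (simp add: word_append)
      with u(3) have "(word_map w x, word_map w' x) \<in> E ^^ Suc (2 * length u)" by auto
      then have "?d (word_map w x) (word_map w' x) \<le> real (Suc (2 * length u))"
        using that by (intro le wL) auto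
      also have "Suc (2 * length u) \<le> (2 * m + 2) * k + (2 * m + 2)"
        using u(1) by (simp add: algebra_simps trans_le_add2)
      then have "real (Suc (2 * length u)) \<le> real ((2 * m + 2) * k + (2 * m + 2))"
        by (rule of_nat_mono)
      finally show ?thesis by (simp add: algebra_simps)
    qed
    show "word_near x w w' k"
      if "w \<in> {w. x \<in> word_dom w}" "w' \<in> {w. x \<in> word_dom w}"
        and small: "?d (word_map w x) (word_map w' x) \<le> real k" for w w' k
    proof -
      have L: "word_map w x \<in> ?L" "word_map w' x \<in> ?L" using that wL by auto
      obtain j where j: "j \<le> k" "(word_map w x, word_map w' x) \<in> E ^^ j"
        using small leaf_dist_le_iff[OF inE[OF L]] by blast
      have "word_map w x \<in> topspace X" using L(1) top by blast
      then obtain u where "length u = j" "word_map w x \<in> word_dom u"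
        "(word_map u (word_map w x), word_map w' x) \<in> E"
        using word_reaches[OF j(2)] by blast
      then show ?thesis
        using that j(1) unfolding word_near_def by (intro exI[of _ u]) (simp add: word_append)
    qed
  qed
qed

text \<open>All leaves are coded by the same words with the same lengths. Only the valid words and
  their nearness vary, each as a Borel condition on one coordinate of the pair.\<close>

lemma borel_in_leaf_cqi: "borel_in (prod_topology X X) (leaf_cqi n X \<A> \<U>)"
proof -
  let ?M = "borel_of (prod_topology X X)"
  have fst: "fst \<in> measurable ?M (borel_of X)" and snd: "snd \<in> measurable ?M (borel_of X)"
    by (intro continuous_map_imp_measurable continuous_map_fst continuous_map_snd)+
  have "Measurable.pred ?M (\<lambda>z. coarse_match word_length {w. fst z \<in> word_dom w} (word_near (fst z))
      {w. snd z \<in> word_dom w} (word_near (snd z)))"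
    using measurable_compose[OF fst pred_word_dom] measurable_compose[OF snd pred_word_dom]
      measurable_compose[OF fst pred_word_near] measurable_compose[OF snd pred_word_near]
    by (intro pred_coarse_match finite_word_length) simp_all
  then have "{z \<in> topspace (prod_topology X X). coarse_match word_length {w. fst z \<in> word_dom w}
      (word_near (fst z)) {w. snd z \<in> word_dom w} (word_near (snd z))} \<in> sets ?M"
    by (simp add: pred_def)
  moreover have "coarsely_quasi_isometric (leaf n X \<A> x) (leaf_dist n X \<A> \<U>)
      (leaf n X \<A> y) (leaf_dist n X \<A> \<U>) \<longleftrightarrow>
      coarse_match word_length {w. x \<in> word_dom w} (word_near x) {w. y \<in> word_dom w} (word_near y)"
    if "x \<in> topspace X" "y \<in> topspace X" for x y
    by (rule coarsely_quasi_isometric_iff_coarse_match[OF coarse_coding_leaf coarse_coding_leaf])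
      (use that in auto)
  then have "leaf_cqi n X \<A> \<U> = {z \<in> topspace (prod_topology X X). coarse_match word_length
      {w. fst z \<in> word_dom w} (word_near (fst z)) {w. snd z \<in> word_dom w} (word_near (snd z))}"
    by (auto simp: leaf_cqi_def)
  ultimately show ?thesis by (simp add: borel_in_iff_sets)
qed

end

lemma (in regular_atlas) borel_in_leaf_cqi: "borel_in (prod_topology X X) (leaf_cqi n X \<A> \<U>)"
proof -
  obtain cs :: "nat \<Rightarrow> ('a, 'z) chart" and m where "{c \<in> \<U>. dom_of c \<noteq> {}} = cs ` {i. i < m}"
    using finite_imp_nat_seg_image_inj_on[OF finite_nonempty_charts] by blast
  then interpret enumerated_atlas n X \<A> \<U> cs m
    by unfold_locales (simp add: lessThan_def)
  show ?thesis by (rule borel_in_leaf_cqi)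
qed

theorem theorem1p1:
  fixes n :: nat
    and X :: "'a topology"
    and \<A> \<U> :: "('a, 'z) chart set"
    and X0 :: "'a set"
    and R :: "'a rel"
  assumes "compact_Polish_foliated_space n X \<A>"
    and "regular_foliated_atlas n X \<A> \<U>"
    and "X0 = no_holonomy_part n X \<A> \<U>"
    and "R = leaf_cqi n X \<A> \<U>"
  shows "borel_in (prod_topology (subtopology X X0) (subtopology X X0)) (R \<inter> X0 \<times> X0) \<and>
         baire_in (prod_topology X X) R \<and>
         (\<forall>E \<in> X0 // (R \<inter> X0 \<times> X0). borel_in (subtopology X X0) E) \<and>
         (\<forall>E \<in> topspace X // R. baire_in X E)"
proof -
  interpret regular_atlas n X \<A> \<U> using assms(1,2) by unfold_locales
  have R: "borel_in (prod_topology X X) R" using borel_in_leaf_cqi assms(4) by simp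
  have sub: "R \<subseteq> topspace X \<times> topspace X" by (auto simp: assms(4) leaf_cqi_def)
  \<comment> \<open>A section is a preimage under \<open>y\<close> \<mapsto> \<open>(x, y)\<close>.
    This map lands in the product only for \<open>x\<close> in \<open>X\<close>; otherwise the
    section is empty.\<close>
  have section_borel: "borel_in (subtopology X S) (R `` {x} \<inter> S)" for S x
  proof (cases "x \<in> topspace X")
    case True
    then have "continuous_map (subtopology X S) (prod_topology X X) (\<lambda>y. (x, y))"
      by (intro continuous_map_pairedI continuous_map_from_subtopology) auto
    from borel_in_continuous_map_preimage[OF this R]
    have "borel_in (subtopology X S) {y \<in> topspace (subtopology X S). (x, y) \<in> R}" .
    moreover have "{y \<in> topspace (subtopology X S). (x, y) \<in> R} = R `` {x} \<inter> S" using sub by auto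
    ultimately show ?thesis by simp
  next
    case False
    then have "R `` {x} \<inter> S = {}" using sub by blast
    then show ?thesis by (simp add: borel_in_def sigma_sets.Empty)
  qed
  let ?X0 = "subtopology X X0"
  \<comment> \<open>The product of the subspaces carries the subspace topology, so the restricted
    relation is the preimage of \<open>R\<close> under a continuous inclusion.\<close>
  have "continuous_map (prod_topology ?X0 ?X0) (prod_topology X X) (\<lambda>z. z)"
    unfolding prod_topology_subtopology
    by (simp add: continuous_map_from_subtopology flip: id_def)
  from borel_in_continuous_map_preimage[OF this R]
  have "borel_in (prod_topology ?X0 ?X0) {z \<in> topspace (prod_topology ?X0 ?X0). z \<in> R}" .
  moreover have "{z \<in> topspace (prod_topology ?X0 ?X0). z \<in> R} = R \<inter> X0 \<times> X0" using sub by auto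
  moreover have "borel_in ?X0 E" if E: "E \<in> X0 // (R \<inter> X0 \<times> X0)" for E
  proof -
    obtain x where "x \<in> X0" "E = (R \<inter> X0 \<times> X0) `` {x}" using E by (rule quotientE)
    then have "E = R `` {x} \<inter> X0" by blast
    then show ?thesis using section_borel by simp
  qed
  moreover have "baire_in X E" if E: "E \<in> topspace X // R" for E
  proof -
    obtain x where "E = R `` {x}" using E by (rule quotientE)
    moreover have "R `` {x} \<inter> topspace X = R `` {x}" using sub by blast
    ultimately show ?thesis
      using section_borel[of "topspace X" x] borel_in_imp_baire_in by simp
  qed
  ultimately show ?thesis using borel_in_imp_baire_in[OF R] by simp
qed

end
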